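(* For any partition $\lambda = (\lambda_1, \lambda_2, \ldots, \lambda_\ell)$ of a positive integer $d$, \[ \mathrm{Map}^{\mathrm{h}}(\lambda) = z(\lambda) \sum_{\mu \vdash d} H^<(\lambda; \mu) \, \mathrm{FSMap}^{\mathrm{h}}(\mu), \] where $\mathrm{Map}^{\mathrm{h}}$ and $\mathrm{FSMap}^{\mathrm{h}}$ are the weighted enumerations of (possibly disconnected) hypermaps and of fully simple hypermaps, and $H^<(\lambda;\mu)$ is the generating series of strictly monotone Hurwitz numbers.
   Context: **Hypermaps.** A map is a finite graph (loops and multiple edges allowed) without isolated vertices, embedded into an oriented compact surface (possibly disconnected) such that the complement of the graph is a disjoint union of topological disks, called faces, together with an ordered tuple of distinct oriented edges (roots), no two adjacent to the same face; an oriented edge is adjacent to the face on its left and incident to the vertex it points to. A hypermap is a map whose faces are coloured blue or red so that each edge is adjacent to one blue face and one red face, and such that each root is adjacent to a blue face. Blue faces with roots are boundary faces (boundary face $i$ is adjacent to the $i$th root), blue faces without roots are internal faces, and red faces are hyperedges. The degree of a face is the number of oriented edges adjacent to it. Each edge is oriented to have a blue face on its left and a red face on its right. Equivalence is by orientation-preserving homeomorphisms preserving all the structure (including colours and the tuple of roots). Hypermaps are counted up to equivalence. **Permutation model.** Equivalently, a hypermap is encoded by $(\sigma_0,\sigma_1,\sigma_2;R)$, where $\sigma_0,\sigma_1,\sigma_2$ are permutations of a finite set $E$ (the edges) with $\sigma_0\sigma_1\sigma_2=\mathrm{id}$ (permutations multiplied right to left), and $R\in E^n$ is a tuple no two entries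 of which lie in the same cycle of $\sigma_2$. Cycles of $\sigma_0$ are vertices (each containing the edges pointing to it), cycles of $\sigma_1$ are red faces (hyperedges), cycles of $\sigma_2$ are blue faces; lengths of cycles of $\sigma_1,\sigma_2$ are degrees. Two such data are equivalent if there is a bijection $\phi:E\to\widetilde E$ sending $R$ to $\widetilde R$ (entry by entry) with $\widetilde\sigma_i=\phi\sigma_i\phi^{-1}$ for $i\in\{0,1,2\}$. **Fully simple.** A boundary edge is an oriented edge adjacent to a boundary face. A hypermap is fully simple if each vertex is incident to at most one boundary edge. **Enumerations.** For positive integers $\mu_1,\dots,\mu_n$, $\mathrm{Map}^{\mathrm{h}}(\mu_1,\dots,\mu_n)$ is the sum, over equivalence classes of hypermaps $M$ with $n$ boundary faces such that boundary face $i$ has degree $\mu_i$ for $i=1,\dots,n$, of the weight \[ \frac{\hbar^{-\chi(M)}}{|\mathrm{Aut}\,M|}\,t_1^{f_1(M)}t_2^{f_2(M)}t_3^{f_3(M)}\cdots u_1^{e_1(M)}u_2^{e_2(M)}u_3^{e_3(M)}\cdots . \] Here $\chi(M)$ is the Euler characteristic of the underlying surface with the interiors of the boundary faces removed (number of vertices minus number of edges plus number of hyperedges plus number of internal faces), $f_i(M)$ is the number of internal faces of degree $i$, $e_i(M)$ is the number of hyperedges of degree $i$, and $|\mathrm{Aut}\,M|$ is the number of automorphisms (self-equivalences of the encoding data, i.e. permutations of the edges arising from orientation-preserving self-homeomorphisms preserving the hypermap and its tuple of roots). $\mathrm{FSMap}^{\mathrm{h}}(\mu_1,\dots,\mu_n)$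 is the same sum restricted to fully simple hypermaps. Each monomial in the $t_i,u_i$ receives contributions from finitely many hypermaps, so both are formal power series in the $t_i,u_i$ with coefficients in $\mathbb{Q}[\hbar,\hbar^{-1}]$. **Strictly monotone Hurwitz numbers.** A sequence $\tau_1,\dots,\tau_k$ of transpositions in $\mathfrak{S}_d$ is strictly monotone if $\tau_i=(a_i\ b_i)$ with $a_i<b_i$ and $b_1<b_2<\dots<b_k$. For partitions $\lambda,\mu$ of $d$ and $k\ge 0$, $H^<_k(\lambda;\mu)$ is $\frac1{d!}$ times the number of tuples $(\rho_\lambda,\tau_1,\dots,\tau_k,\rho_\mu)$ of permutations in $\mathfrak{S}_d$ such that $\rho_\lambda$ has cycle type $\lambda$, $\rho_\mu$ has cycle type $\mu$, $\tau_1,\dots,\tau_k$ is a strictly monotone sequence of transpositions, and $\rho_\lambda\tau_1\cdots\tau_k\rho_\mu=\mathrm{id}$. Set $H^<(\lambda;\mu)=\sum_{k\ge0}H^<_k(\lambda;\mu)\,\hbar^k$ (a polynomial in $\hbar$). **Notation.** $\mu\vdash d$ means $\mu$ is a partition of $d$; $z(\lambda)=\prod_{i=1}^{\ell(\lambda)}\lambda_i\cdot\prod_{j\ge1}m_j(\lambda)!$, where $\ell(\lambda)$ is the number of parts and $m_j(\lambda)$ is the number of parts equal to $j$. *)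

theory Defs
  imports
    Complex_Main
    "HOL-Library.Poly_Mapping"
    "HOL-Library.Multiset"
    "HOL-Library.Groups_Big_Fun"
    "HOL-Combinatorics.Permutations"
    "HOL-Combinatorics.Orbits"
begin

section \<open>Coefficients and power series\<close>

text \<open>
  Laurent polynomials in \<open>\<hbar>\<close> over the rationals are finitely supported functions on the
  exponents, with the convolution product of \<^theory>\<open>HOL-Library.Poly_Mapping\<close>.
  A formal power series in \<open>t\<^sub>1, t\<^sub>2, \<dots>\<close> and \<open>u\<^sub>1, u\<^sub>2, \<dots>\<close> is the family of its coefficients: the value
  at \<open>a b\<close> is the coefficient of the monomial \<open>\<Prod>i. t\<^sub>i ^ a i * u\<^sub>i ^ b i\<close>. The index type also
  allows variables \<open>t\<^sub>0\<close> and \<open>u\<^sub>0\<close>; they never occur, since no face has degree 0.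
\<close>

type_synonym laurent = "int \<Rightarrow>\<^sub>0 rat"
type_synonym series = "(nat \<Rightarrow>\<^sub>0 nat) \<Rightarrow> (nat \<Rightarrow>\<^sub>0 nat) \<Rightarrow> laurent"

section \<open>Partitions and permutations\<close>

definition is_partition :: "nat \<Rightarrow> nat list \<Rightarrow> bool" where
  "is_partition d lam \<longleftrightarrow>
     sorted_wrt (\<ge>) lam \<and> (\<forall>x\<in>set lam. 0 < x) \<and> sum_list lam = d"

text \<open>Parts that do not occur contribute the factor \<open>0! = 1\<close> to the second product.\<close>

definition zee :: "nat list \<Rightarrow> nat" where
  "zee lam = prod_list lam * (\<Prod>j\<in>set lam. fact (count_list lam j))"

text \<open>Fixed points count as cycles of length 1.\<close>

definition cycles_on :: "'e set \<Rightarrow> ('e \<Rightarrow> 'e) \<Rightarrow> 'e set set" where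
  "cycles_on E p = orbit p ` E"

definition cycle_type_on :: "'e set \<Rightarrow> ('e \<Rightarrow> 'e) \<Rightarrow> nat multiset" where
  "cycle_type_on E p = image_mset card (mset_set (cycles_on E p))"

section \<open>Hypermaps\<close>

record 'e hypermap =
  edges :: "'e set"
  sig0 :: "'e \<Rightarrow> 'e"
  sig1 :: "'e \<Rightarrow> 'e"
  sig2 :: "'e \<Rightarrow> 'e"
  roots :: "'e list"

definition is_hypermap :: "'e hypermap \<Rightarrow> bool" where
  "is_hypermap M \<longleftrightarrow>
     finite (edges M) \<and>
     sig0 M permutes edges M \<and> sig1 M permutes edges M \<and> sig2 M permutes edges M \<and>
     sig0 M \<circ> sig1 M \<circ> sig2 M = id \<and>
     set (roots M) \<subseteq> edges M \<and>
     (\<forall>i<length (roots M). \<forall>j<length (roots M). i \<noteq> j \<longrightarrow>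
        orbit (sig2 M) (roots M ! i) \<noteq> orbit (sig2 M) (roots M ! j))"

definition vertices :: "'e hypermap \<Rightarrow> 'e set set" where
  "vertices M = cycles_on (edges M) (sig0 M)"

definition hyperedges :: "'e hypermap \<Rightarrow> 'e set set" where
  "hyperedges M = cycles_on (edges M) (sig1 M)"

definition blue_faces :: "'e hypermap \<Rightarrow> 'e set set" where
  "blue_faces M = cycles_on (edges M) (sig2 M)"

definition boundary_faces :: "'e hypermap \<Rightarrow> 'e set list" where
  "boundary_faces M = map (orbit (sig2 M)) (roots M)"

definition internal_faces :: "'e hypermap \<Rightarrow> 'e set set" where
  "internal_faces M = blue_faces M - set (boundary_faces M)"

definition boundary_edges :: "'e hypermap \<Rightarrow> 'e set" where
  "boundary_edges M = \<Union>(set (boundary_faces M))"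

definition fully_simple :: "'e hypermap \<Rightarrow> bool" where
  "fully_simple M \<longleftrightarrow> (\<forall>v\<in>vertices M. card (v \<inter> boundary_edges M) \<le> 1)"

definition euler_char :: "'e hypermap \<Rightarrow> int" where
  "euler_char M =
     int (card (vertices M)) - int (card (edges M))
     + int (card (hyperedges M)) + int (card (internal_faces M))"

definition hypermap_iso :: "('e \<Rightarrow> 'e) \<Rightarrow> 'e hypermap \<Rightarrow> 'e hypermap \<Rightarrow> bool" where
  "hypermap_iso \<phi> M N \<longleftrightarrow>
     bij_betw \<phi> (edges M) (edges N) \<and>
     (\<forall>x\<in>edges M. \<phi> (sig0 M x) = sig0 N (\<phi> x)) \<and>
     (\<forall>x\<in>edges M. \<phi> (sig1 M x) = sig1 N (\<phi> x)) \<and>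
     (\<forall>x\<in>edges M. \<phi> (sig2 M x) = sig2 N (\<phi> x)) \<and>
     map \<phi> (roots M) = roots N"

definition hypermap_equiv :: "('e hypermap \<times> 'e hypermap) set" where
  "hypermap_equiv = {(M, N). is_hypermap M \<and> is_hypermap N \<and> (\<exists>\<phi>. hypermap_iso \<phi> M N)}"

text \<open>Automorphisms are extended by the identity outside the edge set, so that each is counted once.\<close>

definition automorphisms :: "'e hypermap \<Rightarrow> ('e \<Rightarrow> 'e) set" where
  "automorphisms M = {\<phi>. \<phi> permutes edges M \<and> hypermap_iso \<phi> M M}"

section \<open>Weighted enumerations\<close>

text \<open>The weight \<open>\<hbar> powi (- \<chi> M) / card (Aut M)\<close>, without the monomial in the \<open>t\<^sub>i\<close> and \<open>u\<^sub>i\<close>.\<close>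

definition hweight :: "'e hypermap \<Rightarrow> laurent" where
  "hweight M =
     Poly_Mapping.single (- euler_char M) (1 / of_nat (card (automorphisms M)))"

definition has_monomial :: "'e hypermap \<Rightarrow> (nat \<Rightarrow>\<^sub>0 nat) \<Rightarrow> (nat \<Rightarrow>\<^sub>0 nat) \<Rightarrow> bool" where
  "has_monomial M a b \<longleftrightarrow>
     (\<forall>i. Poly_Mapping.lookup a i = card {f\<in>internal_faces M. card f = i}) \<and>
     (\<forall>i. Poly_Mapping.lookup b i = card {h\<in>hyperedges M. card h = i})"

text \<open>
  Every finite set of edges is in bijection with a finite set of natural numbers, so hypermaps with
  edges in \<^typ>\<open>nat\<close> represent all equivalence classes. A class is weighted through any of
  its members, the weight being an invariant. The set of classes is finite:
  the number of edges is the sum of the boundary degrees and of the \<open>i * a i\<close>.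
\<close>

definition enumeration :: "(nat hypermap \<Rightarrow> bool) \<Rightarrow> nat list \<Rightarrow> series" where
  "enumeration P mu a b =
     (\<Sum>C \<in> {M. is_hypermap M \<and> P M \<and> map card (boundary_faces M) = mu \<and> has_monomial M a b}
             // hypermap_equiv.
        hweight (SOME M. M \<in> C))"

definition Map_h :: "nat list \<Rightarrow> series" where
  "Map_h = enumeration (\<lambda>_. True)"

definition FSMap_h :: "nat list \<Rightarrow> series" where
  "FSMap_h = enumeration fully_simple"

section \<open>Strictly monotone Hurwitz numbers\<close>

definition strictly_monotone_transpositions :: "nat \<Rightarrow> (nat \<Rightarrow> nat) list \<Rightarrow> bool" where
  "strictly_monotone_transpositions d ts \<longleftrightarrow>
     (\<exists>ps :: (nat \<times> nat) list.
        (\<forall>(a, b)\<in>set ps. 1 \<le> a \<and> a < b \<and> b \<le> d) \<and>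
        sorted_wrt (<) (map snd ps) \<and>
        ts = map (\<lambda>(a, b). transpose a b) ps)"

definition hurwitz_tuples ::
  "nat \<Rightarrow> nat list \<Rightarrow> nat list \<Rightarrow> ((nat \<Rightarrow> nat) \<times> (nat \<Rightarrow> nat) list \<times> (nat \<Rightarrow> nat)) set" where
  "hurwitz_tuples k lam mu =
     (let d = sum_list lam in
      {(\<rho>, ts, \<rho>').
         \<rho> permutes {1..d} \<and> cycle_type_on {1..d} \<rho> = mset lam \<and>
         \<rho>' permutes {1..d} \<and> cycle_type_on {1..d} \<rho>' = mset mu \<and>
         length ts = k \<and> strictly_monotone_transpositions d ts \<and>
         \<rho> \<circ> foldr (\<circ>) ts id \<circ> \<rho>' = id})"

definition hurwitz_number :: "nat \<Rightarrow> nat list \<Rightarrow> nat list \<Rightarrow> rat" where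
  "hurwitz_number k lam mu =
     of_nat (card (hurwitz_tuples k lam mu)) / fact (sum_list lam)"

text \<open>
  \<^const>\<open>Sum_any\<close> sums over the indices with nonzero term. These are finitely many, as a strictly
  monotone sequence has fewer than \<open>d\<close> members.
\<close>

definition hurwitz_series :: "nat list \<Rightarrow> nat list \<Rightarrow> laurent" where
  "hurwitz_series lam mu =
     Sum_any (\<lambda>k::nat. Poly_Mapping.single (int k) (hurwitz_number k lam mu))"

end

theory Submission
  imports Defs
begin

text \<open>
  Let \<open>B\<close> be the set of boundary edges of a hypermap. How its vertices pinch the boundary is recorded by
  the first return map \<open>\<pi>\<close> of \<open>\<sigma>\<^sub>0\<close> to \<open>B\<close>: the edge \<open>\<pi> b\<close> is the next boundary edge met when turning
  around the vertex that \<open>b\<close> points to. Replacing \<open>\<sigma>\<^sub>0\<close> by \<open>\<pi>\<^sup>-\<^sup>1 \<sigma>\<^sub>0\<close> splits every such vertex into one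
  vertex for each boundary edge at it. The relation \<open>\<sigma>\<^sub>0 \<sigma>\<^sub>1 \<sigma>\<^sub>2 = id\<close> survives if \<open>\<sigma>\<^sub>2\<close> is replaced by
  \<open>\<sigma>\<^sub>2 \<pi>\<close>, which leaves hyperedges and internal faces alone and only rearranges the boundary faces.
  The new hypermap is fully simple. Conversely, any permutation \<open>\<pi>\<close> of the boundary edges of a fully
  simple hypermap reglues its vertices, \<open>\<sigma>\<^sub>0 := \<pi> \<sigma>\<^sub>0\<close> and \<open>\<sigma>\<^sub>2 := \<sigma>\<^sub>2 \<pi>\<^sup>-\<^sup>1\<close>, and \<open>\<pi>\<close> is then the first return
  map of the new \<open>\<sigma>\<^sub>0\<close>. So hypermaps with boundary degrees \<open>\<lambda>\<close> correspond to
  fully simple hypermaps together with a permutation \<open>\<pi>\<close> of \<open>B\<close> for which \<open>\<sigma>\<^sub>2 \<pi>\<^sup>-\<^sup>1\<close> has type \<open>\<lambda>\<close> on \<open>B\<close>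
  (\<open>sum_regluings\<close>). Regluing lowers the number of vertices by \<open>card B\<close> minus the number of cycles of \<open>\<pi>\<close>
  (\<open>card_cycles_on_comp\<close>), so it multiplies the weight by that power of \<open>\<hbar>\<close>.

  Strictly monotone Hurwitz numbers carry the same power of \<open>\<hbar>\<close>: a permutation \<open>\<pi>\<close> of \<open>{1..d}\<close> is
  in exactly one way the product of a strictly monotone sequence of transpositions, and the length of
  that sequence is \<open>d\<close> minus the number of cycles of \<open>\<pi>\<close>
  (\<open>ex1_strictly_monotone_factorisation\<close>, \<open>length_strictly_monotone_factorisation\<close>). Hence
  \<open>H\<^sup>< (\<lambda>; \<mu>)\<close> is \<open>1 / d!\<close> times the sum of these powers over the pairs of a permutation \<open>\<rho>\<close> of type \<open>\<mu>\<close>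
  and a permutation \<open>\<pi>\<close> for which \<open>\<pi> \<rho>\<close> has type \<open>\<lambda>\<close>.

  The remaining work is the bookkeeping of symmetries. A class of hypermaps with \<open>N\<close> edges has
  \<open>N! / card Aut\<close> members with the edge set \<open>{..<N}\<close>, so \<open>N!\<close> times a coefficient
  of an enumeration is a sum of powers of \<open>\<hbar>\<close> over labelled hypermaps (\<open>sum_hweight_classes\<close>). A permutation of type \<open>\<mu>\<close> admits \<open>z(\<mu>)\<close> tuples of
  roots with the orbit lengths \<open>\<mu>\<close> (\<open>card_root_lists\<close>), so forgetting the positions of the
  roots costs a factor \<open>z(\<mu>)\<close>. If root tuples are chosen for two permutations of type \<open>\<mu>\<close>, then exactly one
  permutation conjugates the first into the second and matches the roots, so \<open>z(\<mu>)\<close> is also the number of permutations conjugating one element of type \<open>\<mu>\<close> into another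
  (\<open>card_conjugators\<close>). Therefore \<open>z(\<mu>) H\<^sup>< (\<lambda>; \<mu>)\<close> is the sum over \<open>\<pi>\<close> for a single \<open>\<rho>\<close>
  (\<open>cofactor_series_eq_hurwitz_series\<close>), which is the contribution of all regluings of one fully simple
  hypermap.
\<close>

section \<open>Cycles of permutations\<close>

lemma permutes_imp_permutation: "finite S \<Longrightarrow> p permutes S \<Longrightarrow> permutation p"
  by (auto simp: permutation_permutes)

lemma orbit_eq_if_mem:
  assumes "permutation p" "y \<in> orbit p x"
  shows "orbit p y = orbit p x"
  using orbit_cyclic_eq3[OF cyclic_on_orbit'[OF assms(1)] assms(2)] .

lemma orbit_eq_iff_mem:
  assumes "permutation p"
  shows "orbit p y = orbit p x \<longleftrightarrow> y \<in> orbit p x"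
  using orbit_eq_if_mem[OF assms] permutation_self_in_orbit[OF assms, of y] by blast

lemma orbit_subset_closed:
  assumes "x \<in> A" "\<And>y. y \<in> A \<Longrightarrow> p y \<in> A"
  shows "orbit p x \<subseteq> A"
proof
  fix y assume "y \<in> orbit p x"
  then show "y \<in> A" by induct (auto simp: assms)
qed

lemma cycles_on_cong:
  assumes "\<And>x. x \<in> A \<Longrightarrow> p x \<in> A" "\<And>x. x \<in> A \<Longrightarrow> p x = q x"
  shows "cycles_on A p = cycles_on A q"
  unfolding cycles_on_def by (intro image_cong refl orbit_cong0[of _ A]) (use assms in auto)

lemma cycle_type_on_cong:
  assumes "\<And>x. x \<in> A \<Longrightarrow> p x \<in> A" "\<And>x. x \<in> A \<Longrightarrow> p x = q x"
  shows "cycle_type_on A p = cycle_type_on A q"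
  unfolding cycle_type_on_def using cycles_on_cong[OF assms] by simp

lemma cycles_on_inv:
  assumes "permutation p"
  shows "cycles_on A (inv p) = cycles_on A p"
  unfolding cycles_on_def using orbit_inv_eq[OF assms] by simp

lemma finite_cycles_on: "finite A \<Longrightarrow> finite (cycles_on A p)"
  by (simp add: cycles_on_def)

lemma Union_cycles_on:
  assumes "permutation p" "\<And>x. x \<in> A \<Longrightarrow> p x \<in> A"
  shows "\<Union>(cycles_on A p) = A"
proof
  show "\<Union>(cycles_on A p) \<subseteq> A"
    using orbit_subset_closed[of _ A p] assms(2) unfolding cycles_on_def by blast
  show "A \<subseteq> \<Union>(cycles_on A p)"
    using permutation_self_in_orbit[OF assms(1)] by (auto simp: cycles_on_def)
qed

lemma cycles_on_disjoint:
  assumes "permutation p" "c \<in> cycles_on A p" "c' \<in> cycles_on A p" "c \<noteq> c'"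
  shows "c \<inter> c' = {}"
proof (rule ccontr)
  assume "c \<inter> c' \<noteq> {}"
  then obtain x where "x \<in> c" "x \<in> c'" by blast
  then have "orbit p x = c" "orbit p x = c'"
    using assms(2,3) orbit_eq_if_mem[OF assms(1)] unfolding cycles_on_def by blast+
  then show False using assms(4) by simp
qed

lemma sum_card_cycles_on:
  assumes "finite A" "permutation p" "\<And>x. x \<in> A \<Longrightarrow> p x \<in> A"
  shows "(\<Sum>c\<in>cycles_on A p. card c) = card A"
proof -
  have "card (\<Union>(cycles_on A p)) = (\<Sum>c\<in>cycles_on A p. card c)"
  proof (rule card_Union_disjoint)
    show "pairwise disjnt (cycles_on A p)"
      using cycles_on_disjoint[OF assms(2)] by (auto simp: pairwise_def disjnt_def)
    show "finite c" if "c \<in> cycles_on A p" for c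
      using that finite_orbit[OF permutation_self_in_orbit[OF assms(2)]] by (auto simp: cycles_on_def)
  qed
  then show ?thesis using Union_cycles_on[OF assms(2,3)] by simp
qed

lemma sum_mset_cycle_type_on:
  assumes "finite A" "permutation p" "\<And>x. x \<in> A \<Longrightarrow> p x \<in> A"
  shows "sum_mset (cycle_type_on A p) = card A"
  using sum_card_cycles_on[OF assms] by (simp add: cycle_type_on_def sum_unfold_sum_mset)

lemma cycle_type_on_pos:
  assumes "permutation p" "k \<in># cycle_type_on A p" "finite A"
  shows "0 < k"
  using assms finite_orbit[OF permutation_self_in_orbit[OF assms(1)]] orbit_nonempty[of p]
  by (auto simp: cycle_type_on_def cycles_on_def card_gt_0_iff)

subsection \<open>Conjugation\<close>

definition conjugate_by :: "('a \<Rightarrow> 'b) \<Rightarrow> ('a \<Rightarrow> 'a) \<Rightarrow> 'b \<Rightarrow> 'b" where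
  "conjugate_by g p = g \<circ> p \<circ> inv g"

lemma conjugate_by_apply: "bij g \<Longrightarrow> conjugate_by g p (g x) = g (p x)"
  by (simp add: conjugate_by_def bij_is_inj)

lemma conjugate_by_eqI:
  assumes "bij g" "\<And>x. q (g x) = g (p x)"
  shows "q = conjugate_by g p"
proof
  fix y show "q y = conjugate_by g p y"
    using assms(2)[of "inv g y"] assms(1) by (simp add: conjugate_by_def bij_is_surj surj_f_inv_f)
qed

lemma conjugate_by_comp: "bij g \<Longrightarrow> conjugate_by g (p \<circ> q) = conjugate_by g p \<circ> conjugate_by g q"
  by (auto simp: conjugate_by_def fun_eq_iff bij_is_inj)

lemma conjugate_by_id [simp]: "bij g \<Longrightarrow> conjugate_by g id = id"
  by (auto simp: conjugate_by_def fun_eq_iff bij_is_surj surj_f_inv_f)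

lemma conjugate_by_id' [simp]: "conjugate_by id p = p"
  by (auto simp: conjugate_by_def)

lemma conjugate_by_conjugate_by:
  "bij g \<Longrightarrow> bij h \<Longrightarrow> conjugate_by h (conjugate_by g p) = conjugate_by (h \<circ> g) p"
  by (auto simp: conjugate_by_def o_inv_distrib fun_eq_iff)

lemma conjugate_by_inv_cancel [simp]:
  "bij g \<Longrightarrow> conjugate_by (inv g) (conjugate_by g p) = p"
  "bij g \<Longrightarrow> conjugate_by g (conjugate_by (inv g) q) = q"
  by (auto simp: conjugate_by_def fun_eq_iff inv_inv_eq bij_is_surj surj_f_inv_f bij_is_inj)

lemma inj_conjugate_by: "bij g \<Longrightarrow> inj_on (conjugate_by g) A"
  by (rule inj_on_inverseI[where g = "conjugate_by (inv g)"]) simp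

lemma bij_conjugate_by: "bij g \<Longrightarrow> bij p \<Longrightarrow> bij (conjugate_by g p)"
  unfolding conjugate_by_def by (intro bij_comp bij_imp_bij_inv)

lemma permutes_conjugate_by:
  assumes "bij g" "p permutes A" shows "conjugate_by g p permutes g ` A"
proof -
  have b: "bij (conjugate_by g p)"
    using bij_conjugate_by[OF assms(1) permutes_bij[OF assms(2)]] .
  have "conjugate_by g p y = y" if "y \<notin> g ` A" for y
  proof -
    have "inv g y \<notin> A"
      using that assms(1) by (metis bij_inv_eq_iff image_eqI)
    then show ?thesis
      using assms by (simp add: conjugate_by_def permutes_not_in bij_is_surj surj_f_inv_f)
  qed
  then show ?thesis using b by (auto simp: permutes_def bij_iff)
qed

lemma permutes_conjugate_by_iff:
  assumes "bij g" shows "conjugate_by g p permutes g ` A \<longleftrightarrow> p permutes A"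
proof
  assume "conjugate_by g p permutes g ` A"
  from permutes_conjugate_by[OF bij_imp_bij_inv[OF assms] this]
  show "p permutes A" unfolding conjugate_by_inv_cancel(1)[OF assms]
    by (simp add: image_image bij_is_inj[OF assms])
qed (rule permutes_conjugate_by[OF assms])

lemma orbit_conjugate_by:
  assumes "bij g" shows "orbit (conjugate_by g p) (g x) = g ` orbit p x"
proof -
  have "(conjugate_by g p ^^ n) (g x) = g ((p ^^ n) x)" for n
    by (induct n) (auto simp: conjugate_by_apply[OF assms])
  then show ?thesis by (auto simp: orbit_altdef)
qed

lemma cycles_on_conjugate_by:
  assumes "bij g" shows "cycles_on (g ` A) (conjugate_by g p) = (`) g ` cycles_on A p"
  by (auto simp: cycles_on_def orbit_conjugate_by[OF assms] image_image)

lemma card_image_bij: "bij g \<Longrightarrow> card (g ` c) = card c"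
  by (meson bij_is_inj card_image inj_on_subset subset_UNIV)

lemma inj_on_image_bij: "bij g \<Longrightarrow> inj_on ((`) g) X"
  by (meson bij_is_inj inj_image_eq_iff inj_onI)

lemma card_cycles_on_conjugate_by:
  assumes "bij g" shows "card (cycles_on (g ` A) (conjugate_by g p)) = card (cycles_on A p)"
  by (simp add: cycles_on_conjugate_by[OF assms] card_image inj_on_image_bij[OF assms])

lemma cycle_type_on_conjugate_by:
  assumes "bij g" shows "cycle_type_on (g ` A) (conjugate_by g p) = cycle_type_on A p"
  by (simp add: cycle_type_on_def cycles_on_conjugate_by[OF assms] image_mset_mset_set[symmetric]
      inj_on_image_bij[OF assms] multiset.map_comp o_def card_image_bij[OF assms])

text \<open>
  Because of this, relabellings of finite structures may always be taken to be bijections of the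
  whole type, and no structure has to be transported along a partial map.
\<close>

lemma extend_bij_betw:
  assumes "finite A" "finite B" "bij_betw f A B"
  obtains g where "g permutes A \<union> B" "\<And>x. x \<in> A \<Longrightarrow> g x = f x"
proof -
  have "card A = card B" using assms(3) by (rule bij_betw_same_card)
  then have "card (B - A) = card (A - B)"
    using assms(1,2) by (metis Int_commute card_Diff_subset_Int finite_Int)
  then obtain h where h: "bij_betw h (B - A) (A - B)"
    using assms(1,2) by (metis finite_Diff finite_same_card_bij)
  define g where "g x = (if x \<in> A then f x else if x \<in> B then h x else x)" for x
  have 1: "bij_betw g A B" using assms(3) by (subst bij_betw_cong[of _ _ f]) (auto simp: g_def)
  have 2: "bij_betw g (B - A) (A - B)" using h by (subst bij_betw_cong[of _ _ h]) (auto simp: g_def)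
  have "bij_betw g (A \<union> (B - A)) (B \<union> (A - B))"
    by (rule bij_betw_combine[OF 1 2]) auto
  then have "g permutes A \<union> B"
    by (intro bij_imp_permutes) (auto simp: g_def Un_commute)
  then show thesis by (rule that) (simp add: g_def)
qed

section \<open>Splitting a permutation along a set\<close>

text \<open>
  For \<open>p\<close> the vertex permutation and \<open>B\<close> the set of boundary edges, this is full simplicity.
\<close>

definition separates :: "('a \<Rightarrow> 'a) \<Rightarrow> 'a set \<Rightarrow> bool" where
  "separates p B \<longleftrightarrow> (\<forall>b\<in>B. orbit p b \<inter> B = {b})"

text \<open>
  Points outside \<open>B\<close> are fixed, so that the first return map of a permutation permutes \<open>B\<close>
  in the sense of \<^const>\<open>permutes\<close>.
\<close>

definition first_return :: "('a \<Rightarrow> 'a) \<Rightarrow> 'a set \<Rightarrow> 'a \<Rightarrow> 'a" where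
  "first_return p B b = (if b \<in> B then (p ^^ (LEAST n. 0 < n \<and> (p ^^ n) b \<in> B)) b else b)"

lemma first_return_eqI:
  assumes "b \<in> B" "0 < n" "(p ^^ n) b \<in> B" "\<And>i. 0 < i \<Longrightarrow> i < n \<Longrightarrow> (p ^^ i) b \<notin> B"
  shows "first_return p B b = (p ^^ n) b"
proof -
  have "(LEAST n. 0 < n \<and> (p ^^ n) b \<in> B) = n"
    by (rule Least_equality) (use assms not_less in blast)+
  then show ?thesis using assms(1) by (simp add: first_return_def)
qed

lemma first_return_obtains:
  assumes "permutation p" "b \<in> B"
  obtains n where "0 < n" "(p ^^ n) b = first_return p B b" "(p ^^ n) b \<in> B"
    "\<And>i. 0 < i \<Longrightarrow> i < n \<Longrightarrow> (p ^^ i) b \<notin> B"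
proof -
  have "b \<in> orbit p b" using permutation_self_in_orbit[OF assms(1)] .
  then obtain m where "0 < m" "(p ^^ m) b = b" unfolding orbit_altdef by force
  then have "0 < m \<and> (p ^^ m) b \<in> B" using assms(2) by simp
  from LeastI[of "\<lambda>n. 0 < n \<and> (p ^^ n) b \<in> B", OF this] show thesis
    by (intro that[of "LEAST n. 0 < n \<and> (p ^^ n) b \<in> B"])
      (use assms(2) not_less_Least[of _ "\<lambda>n. 0 < n \<and> (p ^^ n) b \<in> B"] in
       \<open>auto simp: first_return_def\<close>)
qed

text \<open>
  Two points of \<open>B\<close> with the same first return lie on one orbit, so one is an iterate of the
  other. A nontrivial iterate in \<open>B\<close> would come before the first return.
\<close>

lemma first_return_permutes:
  assumes "permutation p" "finite B"
  shows "first_return p B permutes B"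
proof (rule inj_imp_permutes[OF _ assms(2)])
  have inj: "inj (p ^^ k)" for k
    using permutation_bijective[OF assms(1)] by (simp add: bij_is_inj inj_fn)
  \<comment> \<open>The claim for return times \<open>m \<le> n\<close>; the other case follows by exchanging \<open>b\<close> and \<open>c\<close>.\<close>
  have wlog: "b = c" if "b \<in> B" "c \<in> B" "0 < m" "m \<le> n" "(p ^^ m) b = (p ^^ n) c"
    "\<And>i. 0 < i \<Longrightarrow> i < n \<Longrightarrow> (p ^^ i) c \<notin> B" for b c m n
  proof -
    have "(p ^^ m) b = (p ^^ m) ((p ^^ (n - m)) c)"
      using that(4,5) by (metis comp_apply funpow_add le_add_diff_inverse)
    then have "b = (p ^^ (n - m)) c" using inj by (simp add: inj_eq)
    then show "b = c" using that by (cases "n - m = 0") auto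
  qed
  show "inj_on (first_return p B) B"
  proof (rule inj_onI)
    fix b c assume bc: "b \<in> B" "c \<in> B" "first_return p B b = first_return p B c"
    obtain m where m: "0 < m" "(p ^^ m) b = first_return p B b"
      "\<And>i. 0 < i \<Longrightarrow> i < m \<Longrightarrow> (p ^^ i) b \<notin> B"
      using first_return_obtains[OF assms(1) bc(1)] by metis
    obtain n where n: "0 < n" "(p ^^ n) c = first_return p B c"
      "\<And>i. 0 < i \<Longrightarrow> i < n \<Longrightarrow> (p ^^ i) c \<notin> B"
      using first_return_obtains[OF assms(1) bc(2)] by metis
    show "b = c"
    proof (cases "m \<le> n")
      case True then show ?thesis using wlog[of b c m n] bc m n by simp
    next
      case False
      then have "n \<le> m" by simp
      have "c = b" by (rule wlog[of c b n m]) (use bc m n \<open>n \<le> m\<close> in auto)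
      then show ?thesis by simp
    qed
  qed
  show "first_return p B b \<in> B" if "b \<in> B" for b
    using first_return_obtains[OF assms(1) that] by metis
qed (simp add: first_return_def)

text \<open>
  Starting from \<open>b\<close>, the composition \<open>inv \<pi> \<circ> p\<close> follows \<open>p\<close> outside \<open>B\<close>; as soon as \<open>p\<close> returns to \<open>B\<close>,
  necessarily at \<open>\<pi> b\<close>, it is sent back to \<open>b\<close>.
\<close>

lemma separates_first_return:
  assumes "permutation p" "finite B"
  shows "separates (inv (first_return p B) \<circ> p) B"
  unfolding separates_def
proof
  fix b assume b: "b \<in> B"
  define \<pi> where "\<pi> = first_return p B"
  define s where "s = inv \<pi> \<circ> p"
  have \<pi>: "\<pi> permutes B" unfolding \<pi>_def by (rule first_return_permutes[OF assms])
  obtain n where n: "0 < n" "(p ^^ n) b = \<pi> b"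
    "\<And>i. 0 < i \<Longrightarrow> i < n \<Longrightarrow> (p ^^ i) b \<notin> B"
    using first_return_obtains[OF assms(1) b] unfolding \<pi>_def by metis
  have eq: "(s ^^ i) b = (p ^^ i) b" if "i < n" for i
    using that
  proof (induct i)
    case (Suc i)
    then have "p ((p ^^ i) b) \<notin> B" using n(3)[of "Suc i"] by simp
    then show ?case using Suc permutes_not_in[OF permutes_inv[OF \<pi>]] by (simp add: s_def)
  qed simp
  have "(s ^^ n) b = b"
  proof (cases n)
    case (Suc k)
    have "(s ^^ n) b = inv \<pi> (p ((p ^^ k) b))" using eq[of k] Suc by (simp add: s_def)
    also have "\<dots> = inv \<pi> (\<pi> b)" using n(2) Suc by simp
    finally show ?thesis using permutes_inverses(2)[OF \<pi>] by simp
  qed (use n in simp)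
  then have orb: "orbit s b = {(s ^^ m) b | m. m < n}"
    using n(1) by (rule orbit_altdef_bounded)
  have "(s ^^ m) b = b" if "m < n" "(s ^^ m) b \<in> B" for m
    using that eq[of m] n(3)[of m] by (cases "m = 0") auto
  moreover have "b \<in> orbit s b"
    unfolding orb using n(1) by (auto intro!: exI[of _ 0])
  ultimately show "orbit (inv (first_return p B) \<circ> p) b \<inter> B = {b}"
    using b orb unfolding s_def \<pi>_def by auto
qed

text \<open>
  The orbit of \<open>b \<in> B\<close> under \<open>s\<close> avoids \<open>B\<close> until it closes up at \<open>b\<close>. Until then \<open>\<pi> \<circ> s\<close> agrees with \<open>s\<close>,
  and at that moment it leads to \<open>\<pi> b\<close>. Together with \<open>separates_first_return\<close>, this makes the
  decomposition of a permutation into \<open>\<pi>\<close> and a permutation separating \<open>B\<close> exist uniquely.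
\<close>

lemma first_return_comp:
  assumes "permutation s" "\<pi> permutes B" "separates s B"
  shows "first_return (\<pi> \<circ> s) B = \<pi>"
proof
  fix b
  show "first_return (\<pi> \<circ> s) B b = \<pi> b"
  proof (cases "b \<in> B")
    case True
    define n where "n = funpow_dist1 s b b"
    have self: "b \<in> orbit s b" using permutation_self_in_orbit[OF assms(1)] .
    have n: "(s ^^ n) b = b" "\<And>i. 0 < i \<Longrightarrow> i < n \<Longrightarrow> (s ^^ i) b \<noteq> b" "0 < n"
      unfolding n_def by (rule funpow_dist1_prop[OF self], erule (1) funpow_dist1_least, simp)
    have notB: "(s ^^ i) b \<notin> B" if "0 < i" "i < n" for i
      using n(2)[OF that] assms(3) funpow_in_orbit[OF self, of i] True
      unfolding separates_def by blast
    have eq: "((\<pi> \<circ> s) ^^ i) b = (s ^^ i) b" if "i < n" for i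
      using that
    proof (induct i)
      case (Suc i)
      then show ?case using notB[of "Suc i"] permutes_not_in[OF assms(2)] by simp
    qed simp
    have "((\<pi> \<circ> s) ^^ n) b = \<pi> b"
    proof (cases n)
      case (Suc k)
      then show ?thesis using eq[of k] n(1) by simp
    qed (use n in simp)
    moreover have "first_return (\<pi> \<circ> s) B b = ((\<pi> \<circ> s) ^^ n) b"
      by (rule first_return_eqI)
        (use True n(3) calculation eq notB permutes_in_image[OF assms(2)] in auto)
    ultimately show ?thesis by simp
  next
    case False
    then show ?thesis using permutes_not_in[OF assms(2)] by (simp add: first_return_def)
  qed
qed

lemma first_return_mem_orbit:
  assumes "permutation p"
  shows "first_return p B b \<in> orbit p b"
proof (cases "b \<in> B")
  case True
  then show ?thesis using first_return_obtains[OF assms True]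
    by (metis funpow_in_orbit permutation_self_in_orbit[OF assms])
next
  case False
  then show ?thesis by (simp add: first_return_def permutation_self_in_orbit[OF assms])
qed

text \<open>
  A cycle of \<open>\<pi> \<circ> s\<close> is made of the cycles of \<open>s\<close> through the points of one cycle of \<open>\<pi>\<close>, strung
  together in the cyclic order given by \<open>\<pi>\<close>.
\<close>

lemma orbit_comp_Int:
  assumes "permutation s" "\<pi> permutes B" "finite B" "separates s B" "b \<in> B"
  shows "orbit (\<pi> \<circ> s) b \<inter> B = orbit \<pi> b"
proof
  have perm: "permutation (\<pi> \<circ> s)"
    using assms by (simp add: permutation_compose permutes_imp_permutation)
  have "\<pi> y \<in> orbit (\<pi> \<circ> s) b" if "y \<in> orbit (\<pi> \<circ> s) b" for y
    using first_return_mem_orbit[OF perm, of B y] orbit_eq_if_mem[OF perm that]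
    by (simp add: first_return_comp[OF assms(1,2,4)])
  then have "orbit \<pi> b \<subseteq> orbit (\<pi> \<circ> s) b"
    by (rule orbit_subset_closed[OF permutation_self_in_orbit[OF perm]])
  then show "orbit \<pi> b \<subseteq> orbit (\<pi> \<circ> s) b \<inter> B"
    using permutes_orbit_subset[OF assms(2,5)] by simp
next
  have perm\<pi>: "permutation \<pi>" using assms(2,3) permutes_imp_permutation by blast
  \<comment> \<open>The union of the cycles to be strung together is closed under \<open>\<pi> \<circ> s\<close> and meets \<open>B\<close> in the cycle of \<open>\<pi>\<close>.\<close>
  define S where "S = (\<Union>c\<in>orbit \<pi> b. orbit s c)"
  have sub: "orbit \<pi> b \<subseteq> B" using permutes_orbit_subset[OF assms(2,5)] .
  have sep: "y = c" if "y \<in> orbit s c" "y \<in> B" "c \<in> orbit \<pi> b" for y c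
    using that sub assms(4) unfolding separates_def by blast
  have "orbit (\<pi> \<circ> s) b \<subseteq> S"
  proof (rule orbit_subset_closed)
    show "b \<in> S"
      using permutation_self_in_orbit[OF perm\<pi>] permutation_self_in_orbit[OF assms(1)]
      unfolding S_def by blast
    fix y assume "y \<in> S"
    then obtain c where c: "c \<in> orbit \<pi> b" "y \<in> orbit s c" unfolding S_def by blast
    from c(2) have sy: "s y \<in> orbit s c" by (rule orbit.step)
    show "(\<pi> \<circ> s) y \<in> S"
    proof (cases "s y \<in> B")
      case True
      with sep[OF sy _ c(1)] have "(\<pi> \<circ> s) y = \<pi> c" by simp
      moreover have "\<pi> c \<in> orbit \<pi> b" using c(1) by (rule orbit.step)
      ultimately show ?thesis
        using permutation_self_in_orbit[OF assms(1), of "\<pi> c"] unfolding S_def by auto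
    next
      case False
      then show ?thesis using c sy permutes_not_in[OF assms(2)] unfolding S_def by auto
    qed
  qed
  then show "orbit (\<pi> \<circ> s) b \<inter> B \<subseteq> orbit \<pi> b"
    using sep unfolding S_def by blast
qed

lemma orbit_comp_disjoint:
  assumes "permutation s" "\<pi> permutes B" "orbit s x \<inter> B = {}"
  shows "orbit (\<pi> \<circ> s) x = orbit s x"
proof (rule orbit_cong[OF permutation_self_in_orbit[OF assms(1)]])
  fix y assume "y \<in> orbit s x"
  then have "s y \<notin> B" using assms(3) orbit.step[of y s x] by blast
  then show "(\<pi> \<circ> s) y = s y" using permutes_not_in[OF assms(2)] by simp
qed

lemma card_cycles_on_split:
  assumes "finite V" "B \<subseteq> V" "permutation p"
  shows "card (cycles_on V p) = card {c \<in> cycles_on V p. c \<inter> B = {}} + card (cycles_on B p)"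
proof -
  have "cycles_on B p = {c \<in> cycles_on V p. c \<inter> B \<noteq> {}}"
  proof
    show "cycles_on B p \<subseteq> {c \<in> cycles_on V p. c \<inter> B \<noteq> {}}"
      using assms(2) permutation_self_in_orbit[OF assms(3)] by (auto simp: cycles_on_def)
    show "{c \<in> cycles_on V p. c \<inter> B \<noteq> {}} \<subseteq> cycles_on B p"
    proof
      fix c assume "c \<in> {c \<in> cycles_on V p. c \<inter> B \<noteq> {}}"
      then obtain x y where "c = orbit p x" "y \<in> orbit p x" "y \<in> B"
        unfolding cycles_on_def by blast
      then show "c \<in> cycles_on B p"
        using orbit_eq_if_mem[OF assms(3)] unfolding cycles_on_def by blast
    qed
  qed
  then have "cycles_on V p = {c \<in> cycles_on V p. c \<inter> B = {}} \<union> cycles_on B p"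
    "{c \<in> cycles_on V p. c \<inter> B = {}} \<inter> cycles_on B p = {}" by blast+
  then show ?thesis
    using finite_cycles_on[OF assms(1), of p]
    by (metis (no_types, lifting) card_Un_disjoint finite_Un)
qed

text \<open>
  Cycles that avoid \<open>B\<close> are common to \<open>s\<close> and \<open>\<pi> \<circ> s\<close>. Those that meet \<open>B\<close> correspond to the elements of \<open>B\<close>
  for \<open>s\<close>, and to the cycles of \<open>\<pi>\<close> for \<open>\<pi> \<circ> s\<close>.
\<close>

lemma card_cycles_on_comp:
  assumes "finite V" "B \<subseteq> V" "permutation s" "\<pi> permutes B" "separates s B"
  shows "card (cycles_on V (\<pi> \<circ> s)) + card B = card (cycles_on V s) + card (cycles_on B \<pi>)"
proof -
  have finB: "finite B" using assms(1,2) finite_subset by blast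
  have perm\<pi>: "permutation \<pi>" using assms(4) finB permutes_imp_permutation by blast
  have perm: "permutation (\<pi> \<circ> s)"
    using assms(3) perm\<pi> by (simp add: permutation_compose)
  have inv: "inv \<pi> \<circ> (\<pi> \<circ> s) = s"
    using permutes_inv_o(2)[OF assms(4)] by (simp add: o_assoc)
  have "{c \<in> cycles_on V (\<pi> \<circ> s). c \<inter> B = {}} = {c \<in> cycles_on V s. c \<inter> B = {}}"
  proof (rule set_eqI)
    fix c
    have "(\<exists>x\<in>V. c = orbit (\<pi> \<circ> s) x \<and> c \<inter> B = {}) \<longleftrightarrow> (\<exists>x\<in>V. c = orbit s x \<and> c \<inter> B = {})"
      using orbit_comp_disjoint[OF assms(3,4)]
        orbit_comp_disjoint[OF perm permutes_inv[OF assms(4)], unfolded inv] by metis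
    then show "c \<in> {c \<in> cycles_on V (\<pi> \<circ> s). c \<inter> B = {}} \<longleftrightarrow> c \<in> {c \<in> cycles_on V s. c \<inter> B = {}}"
      unfolding cycles_on_def by blast
  qed
  moreover have "card (cycles_on B s) = card B"
    unfolding cycles_on_def
  proof (rule card_image, rule inj_onI)
    fix b c assume "b \<in> B" "c \<in> B" "orbit s b = orbit s c"
    then show "b = c" using assms(5) unfolding separates_def by (metis singleton_inject)
  qed
  moreover have "card (cycles_on B (\<pi> \<circ> s)) = card (cycles_on B \<pi>)"
  proof (rule bij_betw_same_card[of "\<lambda>c. c \<inter> B"])
    note Int = orbit_comp_Int[OF assms(3,4) finB assms(5)]
    show "bij_betw (\<lambda>c. c \<inter> B) (cycles_on B (\<pi> \<circ> s)) (cycles_on B \<pi>)"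
      unfolding bij_betw_def
    proof
      show "(\<lambda>c. c \<inter> B) ` cycles_on B (\<pi> \<circ> s) = cycles_on B \<pi>"
        unfolding cycles_on_def image_image using Int by (intro image_cong refl) simp
      show "inj_on (\<lambda>c. c \<inter> B) (cycles_on B (\<pi> \<circ> s))"
      proof (rule inj_onI)
        fix c c' assume "c \<in> cycles_on B (\<pi> \<circ> s)" "c' \<in> cycles_on B (\<pi> \<circ> s)" and eq: "c \<inter> B = c' \<inter> B"
        then obtain x y where xy: "x \<in> B" "c = orbit (\<pi> \<circ> s) x" "c' = orbit (\<pi> \<circ> s) y"
          by (auto simp: cycles_on_def)
        then have "x \<in> orbit (\<pi> \<circ> s) y"
          using eq permutation_self_in_orbit[OF perm, of x] by blast
        then show "c = c'" using xy orbit_eq_if_mem[OF perm] by simp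
      qed
    qed
  qed
  ultimately show ?thesis
    using card_cycles_on_split[OF assms(1,2) perm] card_cycles_on_split[OF assms(1-3)] by simp
qed

text \<open>
  The two orders of composition are conjugate by \<open>\<pi>\<close>.
\<close>

lemma card_cycles_on_comp_right:
  assumes "finite V" "B \<subseteq> V" "s permutes V" "\<pi> permutes B" "separates s B"
  shows "card (cycles_on V (s \<circ> \<pi>)) + card B = card (cycles_on V s) + card (cycles_on B \<pi>)"
proof -
  have \<pi>V: "\<pi> permutes V" using permutes_subset[OF assms(4,2)] .
  have "\<pi> \<circ> s = conjugate_by \<pi> (s \<circ> \<pi>)"
    by (rule conjugate_by_eqI) (use permutes_bij[OF assms(4)] in auto)
  then have "card (cycles_on V (s \<circ> \<pi>)) = card (cycles_on V (\<pi> \<circ> s))"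
    using card_cycles_on_conjugate_by[OF permutes_bij[OF assms(4)], of V "s \<circ> \<pi>"]
    by (simp add: permutes_image[OF \<pi>V])
  then show ?thesis
    using card_cycles_on_comp[OF assms(1,2) permutes_imp_permutation[OF assms(1,3)] assms(4,5)] by simp
qed

section \<open>Strictly monotone factorisations\<close>

lemma strictly_monotone_transpositions_0: "strictly_monotone_transpositions 0 ts \<longleftrightarrow> ts = []"
proof
  assume "strictly_monotone_transpositions 0 ts"
  then obtain ps :: "(nat \<times> nat) list" where ps: "\<forall>(a, b)\<in>set ps. 1 \<le> a \<and> a < b \<and> b \<le> 0"
    "ts = map (\<lambda>(a, b). transpose a b) ps"
    unfolding strictly_monotone_transpositions_def by blast
  then show "ts = []" by (cases ps) auto
qed (auto simp: strictly_monotone_transpositions_def)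

text \<open>
  Only the last transposition of a strictly monotone sequence can move the largest point. This is
  the recursion on which the facts about strictly monotone factorisations rest.
\<close>

lemma strictly_monotone_transpositions_Suc:
  "strictly_monotone_transpositions (Suc d) ts \<longleftrightarrow>
     strictly_monotone_transpositions d ts \<or>
     (\<exists>a ts'. 1 \<le> a \<and> a \<le> d \<and> strictly_monotone_transpositions d ts' \<and> ts = ts' @ [transpose a (Suc d)])"
  (is "?L \<longleftrightarrow> ?R1 \<or> ?R2")
proof
  assume ?L
  then obtain ps where ps: "\<forall>(a, b)\<in>set ps. 1 \<le> a \<and> a < b \<and> b \<le> Suc d"
    "sorted_wrt (<) (map snd ps)" "ts = map (\<lambda>(a, b). transpose a b) ps"
    unfolding strictly_monotone_transpositions_def by blast
  show "?R1 \<or> ?R2"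
  proof (cases "\<exists>qs a. ps = qs @ [(a, Suc d)]")
    case True
    then obtain qs a where qs: "ps = qs @ [(a, Suc d)]" by blast
    have "strictly_monotone_transpositions d (map (\<lambda>(a, b). transpose a b) qs)"
      unfolding strictly_monotone_transpositions_def
      by (rule exI[of _ qs]) (use ps qs in \<open>fastforce simp: sorted_wrt_append\<close>)
    then show ?thesis using ps qs by auto
  next
    case False
    have "b \<le> d" if "(a, b) \<in> set ps" for a b
    proof (rule ccontr)
      assume "\<not> b \<le> d"
      then have b: "b = Suc d" using ps(1) that by fastforce
      from that obtain xs ys where xy: "ps = xs @ (a, b) # ys" by (meson split_list)
      with False b obtain a' b' ys' where "ys = (a', b') # ys'"
        by (metis append_Nil2 list.exhaust surj_pair)
      with xy ps(2) have "b < b'" by (simp add: sorted_wrt_append)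
      moreover have "b' \<le> Suc d" using ps(1) xy \<open>ys = _\<close> by fastforce
      ultimately show False using b by simp
    qed
    then have "strictly_monotone_transpositions d ts"
      unfolding strictly_monotone_transpositions_def
      by (intro exI[of _ ps]) (use ps in fastforce)
    then show ?thesis ..
  qed
next
  assume "?R1 \<or> ?R2"
  then show ?L
  proof
    assume ?R1
    then show ?L unfolding strictly_monotone_transpositions_def
      by (metis (mono_tags, lifting) case_prod_beta le_SucI)
  next
    assume ?R2
    then obtain a ts' where a: "1 \<le> a" "a \<le> d" "strictly_monotone_transpositions d ts'"
      "ts = ts' @ [transpose a (Suc d)]" by blast
    then obtain ps where ps: "\<forall>(a, b)\<in>set ps. 1 \<le> a \<and> a < b \<and> b \<le> d"
      "sorted_wrt (<) (map snd ps)" "ts' = map (\<lambda>(a, b). transpose a b) ps"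
      unfolding strictly_monotone_transpositions_def by blast
    show ?L unfolding strictly_monotone_transpositions_def
      by (rule exI[of _ "ps @ [(a, Suc d)]"]) (use ps a in \<open>fastforce simp: sorted_wrt_append\<close>)
  qed
qed

definition comp_list :: "('a \<Rightarrow> 'a) list \<Rightarrow> 'a \<Rightarrow> 'a" where
  "comp_list ts = foldr (\<circ>) ts id"

lemma comp_list_Nil [simp]: "comp_list [] = id"
  by (simp add: comp_list_def fun_eq_iff)

lemma comp_list_snoc: "comp_list (ts @ [t]) = comp_list ts \<circ> t"
proof -
  have "foldr (\<circ>) us t = foldr (\<circ>) us id \<circ> t" for us :: "('a \<Rightarrow> 'a) list"
    by (induct us) (auto simp: fun_eq_iff)
  then show ?thesis by (simp add: comp_list_def)
qed

lemma comp_list_strictly_monotone_permutes: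
  "strictly_monotone_transpositions d ts \<Longrightarrow> comp_list ts permutes {1..d}"
proof (induct d arbitrary: ts)
  case 0
  then show ?case by (auto simp: strictly_monotone_transpositions_0 fun_eq_iff)
next
  case (Suc d)
  have sub: "p permutes {1..Suc d}" if "p permutes {1..d}" for p :: "nat \<Rightarrow> nat"
    using permutes_subset[OF that] by simp
  from Suc(2) consider "strictly_monotone_transpositions d ts"
    | a ts' where "1 \<le> a" "a \<le> d" "strictly_monotone_transpositions d ts'"
        "ts = ts' @ [transpose a (Suc d)]" unfolding strictly_monotone_transpositions_Suc by blast
  then show ?case
  proof cases
    case 1
    then show ?thesis by (intro sub Suc(1))
  next
    case 2
    then show ?thesis unfolding 2(4) comp_list_snoc
      by (intro permutes_compose sub Suc(1) permutes_swap_id) auto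
  qed
qed

lemma separates_fixed:
  assumes "p permutes S" "finite S" "a \<in> S" "b \<notin> S"
  shows "separates p {a, b}"
proof -
  have "orbit p a \<subseteq> S" using permutes_orbit_subset[OF assms(1,3)] .
  moreover have "orbit p b = {b}" using permutes_not_in[OF assms(1,4)] by (simp add: orbit_eq_singleton_iff)
  moreover have "a \<in> orbit p a"
    using permutation_self_in_orbit[OF permutes_imp_permutation[OF assms(2,1)]] .
  ultimately show ?thesis using assms(3,4) unfolding separates_def by auto
qed

lemma card_cycles_on_insert_fixed:
  assumes "p permutes S" "finite S" "b \<notin> S"
  shows "card (cycles_on (insert b S) p) = Suc (card (cycles_on S p))"
proof -
  have b: "orbit p b = {b}" using permutes_not_in[OF assms(1,3)] by (simp add: orbit_eq_singleton_iff)
  have "{b} \<notin> cycles_on S p"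
    using permutes_orbit_subset[OF assms(1)] assms(3) by (auto simp: cycles_on_def)
  then show ?thesis
    using finite_cycles_on[OF assms(2), of p] b by (simp add: cycles_on_def)
qed

lemma cycles_on_transpose:
  "cycles_on {a, b} (transpose a b) = {{a, b}}"
proof -
  have "orbit (transpose a b) x = {a, b}" if "x \<in> {a, b}" for x
  proof
    show "orbit (transpose a b) x \<subseteq> {a, b}"
      by (rule orbit_subset_closed) (use that in auto)
    have "transpose a b x \<in> orbit (transpose a b) x"
      "transpose a b (transpose a b x) \<in> orbit (transpose a b) x"
      by (intro orbit.intros)+
    then show "{a, b} \<subseteq> orbit (transpose a b) x" using that by auto
  qed
  then show ?thesis by (auto simp: cycles_on_def)
qed

text \<open>
  In each step the point \<open>Suc d\<close> is fixed by the earlier transpositions, so the transposition that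
  moves it joins its cycle of length 1 to another cycle: this is \<open>card_cycles_on_comp_right\<close>
  for the two-element set of the transposed points.
\<close>

lemma length_strictly_monotone_factorisation:
  "strictly_monotone_transpositions d ts \<Longrightarrow>
     length ts + card (cycles_on {1..d} (comp_list ts)) = d"
proof (induct d arbitrary: ts)
  case 0
  then show ?case by (simp add: strictly_monotone_transpositions_0 cycles_on_def)
next
  case (Suc d)
  have ins: "{1..Suc d} = insert (Suc d) {1..d}" by auto
  from Suc(2) consider (same) "strictly_monotone_transpositions d ts"
    | (snoc) a ts' where "1 \<le> a" "a \<le> d" "strictly_monotone_transpositions d ts'"
        "ts = ts' @ [transpose a (Suc d)]" unfolding strictly_monotone_transpositions_Suc by blast
  then show ?case
  proof cases
    case same
    show ?thesis
      using Suc(1)[OF same] card_cycles_on_insert_fixed[OF comp_list_strictly_monotone_permutes[OF same], of "Suc d"]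
      unfolding ins by simp
  next
    case snoc
    define s where "s = comp_list ts'"
    have s: "s permutes {1..d}" unfolding s_def by (rule comp_list_strictly_monotone_permutes[OF snoc(3)])
    have sS: "s permutes {1..Suc d}" by (rule permutes_subset[OF s]) auto
    have "card (cycles_on {1..Suc d} (s \<circ> transpose a (Suc d))) + card {a, Suc d} =
      card (cycles_on {1..Suc d} s) + card (cycles_on {a, Suc d} (transpose a (Suc d)))"
      by (rule card_cycles_on_comp_right)
        (use snoc s sS in \<open>auto intro!: permutes_swap_id separates_fixed\<close>)
    also have "card (cycles_on {1..Suc d} s) = Suc (card (cycles_on {1..d} s))"
      unfolding ins by (rule card_cycles_on_insert_fixed[OF s]) auto
    finally show ?thesis
      using Suc(1)[OF snoc(3)] snoc(2) unfolding snoc(4) comp_list_snoc s_def[symmetric]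
      by (simp add: cycles_on_transpose)
  qed
qed

text \<open>
  If \<open>p\<close> moves the largest point \<open>e\<close>, then the last transposition must exchange \<open>e\<close> with the point
  that \<open>p\<close> sends to \<open>e\<close>; what remains permutes the smaller points.
\<close>

lemma ex1_strictly_monotone_factorisation:
  "p permutes {1..d} \<Longrightarrow> \<exists>!ts. strictly_monotone_transpositions d ts \<and> comp_list ts = p"
proof (induct d arbitrary: p)
  case 0
  then show ?case by (auto simp: strictly_monotone_transpositions_0)
next
  case (Suc d)
  define e where "e = Suc d"
  have fixes_e: "comp_list ts e = e" if "strictly_monotone_transpositions d ts" for ts
    using permutes_not_in[OF comp_list_strictly_monotone_permutes[OF that], of e] by (simp add: e_def)
  show ?case
  proof (cases "p e = e")
    case True
    have "p permutes {1..d}"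
      by (rule permutes_superset[OF Suc(2)]) (use True in \<open>auto simp: e_def le_Suc_eq\<close>)
    from Suc(1)[OF this] obtain ts where ts: "strictly_monotone_transpositions d ts"
      "comp_list ts = p"
      and uniq: "\<And>us. strictly_monotone_transpositions d us \<Longrightarrow> comp_list us = p \<Longrightarrow> us = ts"
      by blast
    show ?thesis
    proof (rule ex1I[of _ ts])
      show "strictly_monotone_transpositions (Suc d) ts \<and> comp_list ts = p"
        using ts by (simp add: strictly_monotone_transpositions_Suc)
      fix us assume us: "strictly_monotone_transpositions (Suc d) us \<and> comp_list us = p"
      then consider "strictly_monotone_transpositions d us"
        | a us' where "1 \<le> a" "a \<le> d" "strictly_monotone_transpositions d us'"
            "us = us' @ [transpose a e]" unfolding strictly_monotone_transpositions_Suc e_def by blast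
      then show "us = ts"
      proof cases
        case 1 then show ?thesis using us uniq by blast
      next
        case 2
        have "p e = comp_list us' a"
          using us unfolding 2(4) comp_list_snoc by auto
        moreover have "comp_list us' a \<in> {1..d}"
          using 2 permutes_in_image[OF comp_list_strictly_monotone_permutes[OF 2(3)]] by simp
        ultimately show ?thesis using True by (simp add: e_def)
      qed
    qed
  next
    case False
    define a where "a = inv p e"
    have pa: "p a = e" unfolding a_def using permutes_inverses(1)[OF Suc(2)] .
    have "a \<in> {1..Suc d}" using pa permutes_in_image[OF Suc(2), of a] by (simp add: e_def)
    moreover have "a \<noteq> e" using pa False by auto
    ultimately have a: "1 \<le> a" "a \<le> d" by (auto simp: e_def)
    define q where "q = p \<circ> transpose a e"
    have p_eq: "p = q \<circ> transpose a e" by (simp add: q_def o_assoc[symmetric])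
    have "q permutes {1..Suc d}"
      unfolding q_def by (intro permutes_compose Suc(2) permutes_swap_id) (use a in \<open>auto simp: e_def\<close>)
    then have "q permutes {1..d}"
      by (rule permutes_superset) (use pa in \<open>auto simp: q_def e_def le_Suc_eq\<close>)
    from Suc(1)[OF this] obtain ts where ts: "strictly_monotone_transpositions d ts"
      "comp_list ts = q"
      and uniq: "\<And>us. strictly_monotone_transpositions d us \<Longrightarrow> comp_list us = q \<Longrightarrow> us = ts"
      by blast
    show ?thesis
    proof (rule ex1I[of _ "ts @ [transpose a e]"])
      show "strictly_monotone_transpositions (Suc d) (ts @ [transpose a e]) \<and>
          comp_list (ts @ [transpose a e]) = p"
        unfolding comp_list_snoc using ts a p_eq by (auto simp: strictly_monotone_transpositions_Suc e_def)
      fix us assume us: "strictly_monotone_transpositions (Suc d) us \<and> comp_list us = p"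
      then consider "strictly_monotone_transpositions d us"
        | b us' where "1 \<le> b" "b \<le> d" "strictly_monotone_transpositions d us'"
            "us = us' @ [transpose b e]" unfolding strictly_monotone_transpositions_Suc e_def by blast
      then show "us = ts @ [transpose a e]"
      proof cases
        case 1 then show ?thesis using fixes_e[OF 1] us False by simp
      next
        case 2
        have p: "p = comp_list us' \<circ> transpose b e"
          using us unfolding 2(4) comp_list_snoc by simp
        have "p b = e" unfolding p using fixes_e[OF 2(3)] by simp
        then have "p b = p a" using pa by simp
        then have "b = a" using permutes_inj[OF Suc(2)] by (simp add: inj_eq)
        moreover from this have "comp_list us' = q"
          unfolding q_def p by (simp add: o_assoc[symmetric])
        ultimately show ?thesis using uniq[OF 2(3)] 2(4) by simp
      qed
    qed
  qed
qed

section \<open>Choosing a root on each cycle\<close>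

text \<open>
  When \<open>p\<close> has cycle type \<open>mset mu\<close> on \<open>S\<close>, a root list picks one point on every cycle, in an order in which the
  cycle lengths read \<open>mu\<close>. For the blue faces along the boundary, these are the admissible tuples of roots.
\<close>

definition root_lists :: "'a set \<Rightarrow> ('a \<Rightarrow> 'a) \<Rightarrow> nat list \<Rightarrow> 'a list set" where
  "root_lists S p mu =
     {R. set R \<subseteq> S \<and> distinct (map (orbit p) R) \<and> map (\<lambda>r. card (orbit p r)) R = mu}"

lemma finite_root_lists: "finite S \<Longrightarrow> finite (root_lists S p mu)"
  by (rule finite_subset[OF _ finite_lists_length_eq[of S "length mu"]]) (auto simp: root_lists_def)

lemma zee_Nil: "zee [] = 1"
  by (simp add: zee_def)

text \<open>
  The form of \<open>z\<close> that matches choosing the roots one after the other.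
\<close>

lemma zee_Cons: "zee (x # mu) = x * Suc (count_list mu x) * zee mu"
proof -
  have "(\<Prod>j\<in>set (x # mu). fact (count_list (x # mu) j)) =
      fact (count_list (x # mu) x) * (\<Prod>j\<in>set mu - {x}. fact (count_list mu j) :: nat)"
    unfolding list.set(2) prod.insert_remove[OF finite_set]
    by (intro arg_cong2[of _ _ _ _ "(*)"] prod.cong) auto
  also have "\<dots> = Suc (count_list mu x) *
      (fact (count_list mu x) * (\<Prod>j\<in>set mu - {x}. fact (count_list mu j)))"
    by (simp add: algebra_simps)
  also have "fact (count_list mu x) * (\<Prod>j\<in>set mu - {x}. fact (count_list mu j)) =
      (\<Prod>j\<in>set mu. fact (count_list mu j) :: nat)"
  proof (cases "x \<in> set mu")
    case True
    then show ?thesis by (simp add: prod.remove)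
  next
    case False
    then show ?thesis by (simp add: count_list_0_iff)
  qed
  finally show ?thesis unfolding zee_def prod_list.Cons by (simp only: mult_ac)
qed

lemma count_cycle_type_on:
  assumes "finite S"
  shows "count (cycle_type_on S p) x = card {c \<in> cycles_on S p. card c = x}"
proof -
  have "count (cycle_type_on S p) x = (\<Sum>c\<in>card -` {x} \<inter> cycles_on S p. count (mset_set (cycles_on S p)) c)"
    using finite_cycles_on[OF assms] by (simp add: cycle_type_on_def count_image_mset)
  also have "\<dots> = (\<Sum>c\<in>card -` {x} \<inter> cycles_on S p. 1)"
    by (intro sum.cong refl) (use finite_cycles_on[OF assms] in auto)
  also have "card -` {x} \<inter> cycles_on S p = {c \<in> cycles_on S p. card c = x}" by auto
  finally show ?thesis by simp
qed

lemma card_points_on_cycles_of_length: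
  assumes "finite S" "permutation p" "\<And>x. x \<in> S \<Longrightarrow> p x \<in> S"
  shows "card {r \<in> S. card (orbit p r) = x} = x * count (cycle_type_on S p) x"
proof -
  let ?C = "{c \<in> cycles_on S p. card c = x}"
  have "{r \<in> S. card (orbit p r) = x} = \<Union>?C"
  proof (intro set_eqI iffI)
    fix r assume "r \<in> {r \<in> S. card (orbit p r) = x}"
    then show "r \<in> \<Union>?C"
      using permutation_self_in_orbit[OF assms(2), of r] unfolding cycles_on_def by blast
  next
    fix r assume "r \<in> \<Union>?C"
    then obtain s where s: "s \<in> S" "card (orbit p s) = x" "r \<in> orbit p s"
      unfolding cycles_on_def by blast
    then show "r \<in> {r \<in> S. card (orbit p r) = x}"
      using orbit_eq_if_mem[OF assms(2) s(3)] orbit_subset_closed[OF s(1), of p] assms(3) by auto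
  qed
  also have "card (\<Union>?C) = (\<Sum>c\<in>?C. card c)"
  proof (rule card_Union_disjoint)
    show "pairwise disjnt ?C"
      using cycles_on_disjoint[OF assms(2)] by (auto simp: pairwise_def disjnt_def)
    show "finite c" if "c \<in> ?C" for c
      using that finite_orbit[OF permutation_self_in_orbit[OF assms(2)]] by (auto simp: cycles_on_def)
  qed
  also have "\<dots> = x * card ?C" by simp
  finally show ?thesis using count_cycle_type_on[OF assms(1)] by simp
qed

lemma cycles_on_Diff_orbit:
  assumes "permutation p"
  shows "cycles_on (S - orbit p r) p = cycles_on S p - {orbit p r}"
proof -
  have "S - orbit p r = {x \<in> S. orbit p x \<noteq> orbit p r}"
    using orbit_eq_iff_mem[OF assms] by blast
  then show ?thesis unfolding cycles_on_def by blast
qed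

lemma cycle_type_on_remove:
  assumes "finite S" "permutation p" "r \<in> S"
  shows "cycle_type_on S p = add_mset (card (orbit p r)) (cycle_type_on (S - orbit p r) p)"
proof -
  have "orbit p r \<in> cycles_on S p" using assms(3) by (simp add: cycles_on_def)
  then have "mset_set (cycles_on S p) = add_mset (orbit p r) (mset_set (cycles_on S p - {orbit p r}))"
    using finite_cycles_on[OF assms(1)] by (rule mset_set.remove[rotated])
  then show ?thesis
    by (simp add: cycle_type_on_def cycles_on_Diff_orbit[OF assms(2)])
qed

text \<open>
  The first root is one of the \<open>x\<close> points on one of the cycles of length \<open>x\<close>; removing its cycle leaves
  the same problem for the remaining lengths.
\<close>

lemma card_root_lists:
  assumes "finite S" "permutation p" "\<And>x. x \<in> S \<Longrightarrow> p x \<in> S" "cycle_type_on S p = mset mu"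
  shows "card (root_lists S p mu) = zee mu"
  using assms(1,3,4)
proof (induct mu arbitrary: S)
  case Nil
  have "root_lists S p [] = {[]}" by (auto simp: root_lists_def)
  then show ?case by (simp add: zee_Nil)
next
  case (Cons x mu)
  let ?X = "{r \<in> S. card (orbit p r) = x}"
  have eq: "root_lists S p (x # mu) = (\<lambda>(r, R). r # R) ` (SIGMA r:?X. root_lists (S - orbit p r) p mu)"
  proof (intro set_eqI iffI)
    fix Q assume "Q \<in> root_lists S p (x # mu)"
    then obtain r R where Q: "Q = r # R" "r \<in> S" "set R \<subseteq> S" "distinct (map (orbit p) R)"
      "orbit p r \<notin> orbit p ` set R" "card (orbit p r) = x" "map (\<lambda>r. card (orbit p r)) R = mu"
      unfolding root_lists_def by auto
    have "set R \<inter> orbit p r = {}"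
      using Q(5) orbit_eq_if_mem[OF assms(2)] by (metis disjoint_iff image_eqI)
    then show "Q \<in> (\<lambda>(r, R). r # R) ` (SIGMA r:?X. root_lists (S - orbit p r) p mu)"
      using Q unfolding root_lists_def by auto
  next
    fix Q assume "Q \<in> (\<lambda>(r, R). r # R) ` (SIGMA r:?X. root_lists (S - orbit p r) p mu)"
    then obtain r R where Q: "Q = r # R" "r \<in> S" "card (orbit p r) = x" "set R \<subseteq> S - orbit p r"
      "distinct (map (orbit p) R)" "map (\<lambda>r. card (orbit p r)) R = mu"
      unfolding root_lists_def by auto
    have "orbit p r \<notin> orbit p ` set R"
    proof
      assume "orbit p r \<in> orbit p ` set R"
      then obtain y where "y \<in> set R" "orbit p r = orbit p y" by blast
      then show False using Q(4) permutation_self_in_orbit[OF assms(2), of y] by blast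
    qed
    then show "Q \<in> root_lists S p (x # mu)" using Q unfolding root_lists_def by auto
  qed
  have inner: "card (root_lists (S - orbit p r) p mu) = zee mu" if "r \<in> ?X" for r
  proof (rule Cons(1))
    show "finite (S - orbit p r)" using Cons(2) by simp
    show "p y \<in> S - orbit p r" if "y \<in> S - orbit p r" for y
      using that Cons(3)[of y] orbit_eq_iff_mem[OF assms(2), of y r]
        orbit_eq_iff_mem[OF assms(2), of "p y" r] permutation_orbit_step[OF assms(2), of y] by simp
    show "cycle_type_on (S - orbit p r) p = mset mu"
      using cycle_type_on_remove[OF Cons(2) assms(2), of r] Cons(4) that by simp
  qed
  have "card (root_lists S p (x # mu)) = card (SIGMA r:?X. root_lists (S - orbit p r) p mu)"
    unfolding eq by (rule card_image) (auto simp: inj_on_def)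
  also have "\<dots> = (\<Sum>r\<in>?X. card (root_lists (S - orbit p r) p mu))"
    using Cons(2) by (intro card_SigmaI) (simp_all add: finite_root_lists)
  also have "\<dots> = card ?X * zee mu" using inner by simp
  also have "card ?X = x * Suc (count_list mu x)"
    using card_points_on_cycles_of_length[of S p x] Cons(2-4) assms(2) by (simp add: count_mset)
  finally show ?case by (simp add: zee_Cons)
qed

lemma orbit_root_list:
  assumes "finite S" "cycle_type_on S p = mset mu" "R \<in> root_lists S p mu"
  shows "orbit p ` set R = cycles_on S p"
proof (rule card_subset_eq[OF finite_cycles_on[OF assms(1)]])
  show "orbit p ` set R \<subseteq> cycles_on S p"
    using assms(3) by (auto simp: root_lists_def cycles_on_def)
  have "card (orbit p ` set R) = length R"
    using assms(3) distinct_card[of "map (orbit p) R"] by (simp add: root_lists_def)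
  also have "\<dots> = size (mset mu)" using assms(3) by (auto simp: root_lists_def)
  also have "\<dots> = card (cycles_on S p)"
    unfolding assms(2)[symmetric] by (simp add: cycle_type_on_def)
  finally show "card (orbit p ` set R) = card (cycles_on S p)" .
qed

lemma root_list_covers:
  assumes "finite S" "permutation p" "cycle_type_on S p = mset mu" "R \<in> root_lists S p mu" "x \<in> S"
  obtains i j where "i < length R" "x = (p ^^ j) (R ! i)"
proof -
  have "orbit p x \<in> orbit p ` set R"
    unfolding orbit_root_list[OF assms(1,3,4)] using assms(5) by (simp add: cycles_on_def)
  then obtain i where "i < length R" "orbit p x = orbit p (R ! i)"
    by (auto simp: in_set_conv_nth)
  then show thesis
    using that orbit_altdef_permutation[OF assms(2)] orbit_eq_iff_mem[OF assms(2)] by blast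
qed

text \<open>
  The points of a cycle are addressed by exponents modulo its length; maps between cycles of equal length
  can therefore be defined through exponents.
\<close>

lemma funpow_eq_iff_mod:
  assumes "permutation p"
  shows "(p ^^ j) r = (p ^^ k) r \<longleftrightarrow> j mod card (orbit p r) = k mod card (orbit p r)"
proof -
  have self: "r \<in> orbit p r" using permutation_self_in_orbit[OF assms] .
  define n where "n = funpow_dist1 p r r"
  have inj: "inj_on (\<lambda>i. (p ^^ i) r) {0..<n}" unfolding n_def by (rule inj_on_funpow_dist1[OF self])
  have n: "card (orbit p r) = n"
    using orbit_conv_funpow_dist1[OF self] card_image[OF inj] by (simp add: n_def)
  have fix_r: "(p ^^ n) r = r" unfolding n_def by (rule funpow_dist1_prop[OF self])
  have "(p ^^ i) r = (p ^^ (i mod n)) r" for i using funpow_mod_eq[OF fix_r] by simp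
  moreover have "i mod n \<in> {0..<n}" for i by (simp add: n_def)
  ultimately show ?thesis unfolding n using inj by (metis inj_onD)
qed

text \<open>
  Every point is an iterate of a root, and a conjugator commutes with iteration, so it is determined
  by its values on the roots.
\<close>

lemma rooted_conjugator_unique:
  assumes "finite S" "permutation p" "cycle_type_on S p = mset mu" "R \<in> root_lists S p mu"
    and "h permutes S" "k permutes S" "conjugate_by h p = conjugate_by k p" "map h R = map k R"
  shows "h = k"
proof
  fix x
  show "h x = k x"
  proof (cases "x \<in> S")
    case True
    obtain i j where ij: "i < length R" "x = (p ^^ j) (R ! i)"
      using root_list_covers[OF assms(1-4) True] .
    have pw: "g ((p ^^ j) y) = (conjugate_by g p ^^ j) (g y)" if "bij g" for g y
      by (induct j) (simp_all add: conjugate_by_apply[OF that, symmetric])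
    have "h (R ! i) = k (R ! i)" using assms(8) ij(1) by (metis nth_map)
    then show ?thesis
      using pw[of h] pw[of k] assms(5-7) ij(2) by (simp add: permutes_bij)
  next
    case False
    then show ?thesis using assms(5,6) by (simp add: permutes_not_in)
  qed
qed

text \<open>
  The \<open>j\<close>-th iterate of the \<open>i\<close>-th root is sent to the \<open>j\<close>-th iterate of the \<open>i\<close>-th root on the other side.
  This is well defined since corresponding cycles have the same length.
\<close>

lemma rooted_conjugator_exists:
  assumes "finite S" "p permutes S" "q permutes S"
    and "cycle_type_on S p = mset mu" "cycle_type_on S q = mset mu"
    and "P \<in> root_lists S p mu" "Q \<in> root_lists S q mu"
  obtains h where "h permutes S" "conjugate_by h p = q" "map h P = Q"
proof -
  have pp: "permutation p" and pq: "permutation q"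
    using assms(1-3) permutes_imp_permutation by blast+
  have len: "length P = length mu" "length Q = length mu"
    using assms(6,7) unfolding root_lists_def by (metis (mono_tags, lifting) length_map mem_Collect_eq)+
  have PS: "P ! i \<in> S" and QS: "Q ! i \<in> S" if "i < length mu" for i
    using that len assms(6,7) unfolding root_lists_def by (metis (mono_tags, lifting) mem_Collect_eq nth_mem subsetD)+
  have cP: "card (orbit p (P ! i)) = mu ! i" and cQ: "card (orbit q (Q ! i)) = mu ! i"
    if "i < length mu" for i
  proof -
    have "map (\<lambda>r. card (orbit p r)) P = mu" "map (\<lambda>r. card (orbit q r)) Q = mu"
      using assms(6,7) by (auto simp: root_lists_def)
    then show "card (orbit p (P ! i)) = mu ! i" "card (orbit q (Q ! i)) = mu ! i"
      using that len by (metis nth_map)+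
  qed
  \<comment> \<open>An address of \<open>x\<close>: the index of its root and an exponent.\<close>
  define rep where "rep x = (SOME (i, j). i < length mu \<and> x = (p ^^ j) (P ! i))" for x
  define g where "g x = (case rep x of (i, j) \<Rightarrow> (q ^^ j) (Q ! i))" for x
  have g: "g ((p ^^ j) (P ! i)) = (q ^^ j) (Q ! i)" if i: "i < length mu" for i j
  proof -
    let ?x = "(p ^^ j) (P ! i)"
    obtain i' j' where r: "rep ?x = (i', j')" by fastforce
    have "case rep ?x of (i', j') \<Rightarrow> i' < length mu \<and> ?x = (p ^^ j') (P ! i')"
      unfolding rep_def by (rule someI[of _ "(i, j)"]) (use i in simp)
    then have ij': "i' < length mu" "(p ^^ j) (P ! i) = (p ^^ j') (P ! i')" using r by auto
    have "orbit p (P ! i) = orbit p (P ! i')"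
      using ij'(2) orbit_eq_if_mem[OF pp] funpow_in_orbit permutation_self_in_orbit[OF pp]
      by metis
    then have "i = i'"
      using assms(6) i ij'(1) len unfolding root_lists_def
      by (auto simp: distinct_conv_nth)
    then have "j mod mu ! i = j' mod mu ! i"
      using ij'(2) funpow_eq_iff_mod[OF pp] cP[OF i] by metis
    then have "(q ^^ j) (Q ! i) = (q ^^ j') (Q ! i)"
      using funpow_eq_iff_mod[OF pq] cQ[OF i] by metis
    then show ?thesis using r \<open>i = i'\<close> by (simp add: g_def)
  qed
  have covP: "\<exists>i j. i < length mu \<and> x = (p ^^ j) (P ! i)" if "x \<in> S" for x
    using root_list_covers[OF assms(1) pp assms(4,6) that] len by metis
  have covQ: "\<exists>i j. i < length mu \<and> x = (q ^^ j) (Q ! i)" if "x \<in> S" for x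
    using root_list_covers[OF assms(1) pq assms(5,7) that] len by metis
  have powS: "(r ^^ j) x \<in> S" if "r permutes S" "x \<in> S" for r j x
    using that by (induct j) (simp_all add: permutes_in_image)
  have gS: "g x \<in> S" if "x \<in> S" for x
    using covP[OF that] g powS[OF assms(3) QS] by metis
  have surj: "S \<subseteq> g ` S"
  proof
    fix y assume "y \<in> S"
    then obtain i j where ij: "i < length mu" "y = (q ^^ j) (Q ! i)" using covQ by blast
    then have "y = g ((p ^^ j) (P ! i))" using g by simp
    then show "y \<in> g ` S" using powS[OF assms(2) PS[OF ij(1)]] by blast
  qed
  define h where "h x = (if x \<in> S then g x else x)" for x
  have "g ` S = S" using surj gS by blast
  then have "inj_on g S" using assms(1) by (simp add: eq_card_imp_inj_on)
  then have hS: "h permutes S"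
    by (intro inj_imp_permutes) (use gS assms(1) in \<open>auto simp: h_def inj_on_def\<close>)
  have "q (h x) = h (p x)" for x
  proof (cases "x \<in> S")
    case True
    then obtain i j where ij: "i < length mu" "x = (p ^^ j) (P ! i)" using covP by blast
    have "g (p x) = q (g x)" using g[OF ij(1), of "Suc j"] g[OF ij(1), of j] ij(2) by simp
    then show ?thesis using True permutes_in_image[OF assms(2)] by (simp add: h_def)
  next
    case False
    then show ?thesis using permutes_in_image[OF assms(2)] permutes_not_in[OF assms(2)]
        permutes_not_in[OF assms(3)] by (simp add: h_def)
  qed
  then have "q = conjugate_by h p" by (rule conjugate_by_eqI[OF permutes_bij[OF hS]])
  moreover have "map h P = Q"
  proof (rule nth_equalityI)
    fix i assume "i < length (map h P)"
    then have i: "i < length mu" using len by simp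
    then show "map h P ! i = Q ! i" using g[OF i, of 0] PS[OF i] len by (simp add: h_def)
  qed (simp add: len)
  ultimately show thesis using that hS by metis
qed

lemma root_lists_conjugate_by:
  assumes "bij g" "R \<in> root_lists S p mu"
  shows "map g R \<in> root_lists (g ` S) (conjugate_by g p) mu"
proof -
  have "map (orbit (conjugate_by g p)) (map g R) = map ((`) g) (map (orbit p) R)"
    by (simp add: orbit_conjugate_by[OF assms(1)])
  then have "distinct (map (orbit (conjugate_by g p)) (map g R))"
    using assms(2) inj_on_image_bij[OF assms(1)]
    by (simp only: distinct_map[of "(`) g"]) (simp add: root_lists_def)
  then show ?thesis
    using assms(2) by (auto simp: root_lists_def orbit_conjugate_by[OF assms(1)] card_image_bij[OF assms(1)])
qed

text \<open>
  For a fixed root list of \<open>p\<close>, the images of its roots under a conjugator form a root list of \<open>q\<close>, and every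
  root list of \<open>q\<close> arises from exactly one conjugator. For \<open>p = q\<close> this is the order of the centralizer.
\<close>

lemma card_conjugators:
  assumes "finite S" "p permutes S" "q permutes S"
    and "cycle_type_on S p = mset mu" "cycle_type_on S q = mset mu"
  shows "card {h. h permutes S \<and> conjugate_by h p = q} = zee mu"
proof -
  have pp: "permutation p" and pq: "permutation q"
    using assms(1-3) permutes_imp_permutation by blast+
  have "zee mu = card (root_lists S p mu)"
    using card_root_lists[OF assms(1) pp _ assms(4)] permutes_in_image[OF assms(2)] by simp
  moreover have "zee mu > 0"
  proof -
    have "0 < x" if "x \<in> set mu" for x
      using cycle_type_on_pos[OF pp _ assms(1), of x] that assms(4) by auto
    then have "prod_list mu \<noteq> 0" by (auto simp: prod_list_zero_iff)
    then show ?thesis by (simp add: zee_def prod_pos)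
  qed
  ultimately obtain P where P: "P \<in> root_lists S p mu" by fastforce
  have "bij_betw (\<lambda>h. map h P) {h. h permutes S \<and> conjugate_by h p = q} (root_lists S q mu)"
    unfolding bij_betw_def
  proof
    show "inj_on (\<lambda>h. map h P) {h. h permutes S \<and> conjugate_by h p = q}"
    proof (rule inj_onI)
      fix h k assume "h \<in> {h. h permutes S \<and> conjugate_by h p = q}"
        "k \<in> {h. h permutes S \<and> conjugate_by h p = q}" "map h P = map k P"
      then show "h = k"
        using rooted_conjugator_unique[OF assms(1) pp assms(4) P, of h k] by simp
    qed
    show "(\<lambda>h. map h P) ` {h. h permutes S \<and> conjugate_by h p = q} = root_lists S q mu"
    proof
      show "(\<lambda>h. map h P) ` {h. h permutes S \<and> conjugate_by h p = q} \<subseteq> root_lists S q mu"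
      proof (rule image_subsetI)
        fix h assume h: "h \<in> {h. h permutes S \<and> conjugate_by h p = q}"
        then have "map h P \<in> root_lists (h ` S) (conjugate_by h p) mu"
          by (auto intro: root_lists_conjugate_by[OF permutes_bij P])
        then show "map h P \<in> root_lists S q mu" using h by (simp add: permutes_image)
      qed
      show "root_lists S q mu \<subseteq> (\<lambda>h. map h P) ` {h. h permutes S \<and> conjugate_by h p = q}"
      proof
        fix Q assume Q: "Q \<in> root_lists S q mu"
        obtain h where "h permutes S" "conjugate_by h p = q" "map h P = Q"
          by (rule rooted_conjugator_exists[OF assms P Q])
        then show "Q \<in> (\<lambda>h. map h P) ` {h. h permutes S \<and> conjugate_by h p = q}" by blast
      qed
    qed
  qed
  then show ?thesis
    using card_root_lists[OF assms(1) pq _ assms(5)] permutes_in_image[OF assms(3)]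
    by (simp add: bij_betw_same_card)
qed

section \<open>Monotone Hurwitz series as sums over permutations\<close>

text \<open>
  The sum of \<open>\<hbar>\<close> to the length of the strictly monotone factorisation of \<open>\<pi>\<close>, over the permutations \<open>\<pi>\<close> that
  complete \<open>\<rho>\<close> to a permutation of type \<open>lam\<close>. The exponent is written through cycles in order to
  make sense on an unordered set.
\<close>

definition cofactor_series :: "'a set \<Rightarrow> nat list \<Rightarrow> ('a \<Rightarrow> 'a) \<Rightarrow> laurent" where
  "cofactor_series S lam \<rho> =
     (\<Sum>\<pi> | \<pi> permutes S \<and> cycle_type_on S (\<pi> \<circ> \<rho>) = mset lam.
        Poly_Mapping.single (int (card S) - int (card (cycles_on S \<pi>))) 1)"

lemma cofactor_series_conjugate_by:
  assumes "bij g"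
  shows "cofactor_series (g ` S) lam (conjugate_by g \<rho>) = cofactor_series S lam \<rho>"
proof -
  have bij: "bij_betw (conjugate_by g)
     {\<pi>. \<pi> permutes S \<and> cycle_type_on S (\<pi> \<circ> \<rho>) = mset lam}
     {\<pi>. \<pi> permutes g ` S \<and> cycle_type_on (g ` S) (\<pi> \<circ> conjugate_by g \<rho>) = mset lam}"
    unfolding bij_betw_def
  proof
    show "inj_on (conjugate_by g) {\<pi>. \<pi> permutes S \<and> cycle_type_on S (\<pi> \<circ> \<rho>) = mset lam}"
      by (rule inj_conjugate_by[OF assms])
    have iff: "conjugate_by g \<pi> permutes g ` S \<and>
        cycle_type_on (g ` S) (conjugate_by g \<pi> \<circ> conjugate_by g \<rho>) = mset lam \<longleftrightarrow>
        \<pi> permutes S \<and> cycle_type_on S (\<pi> \<circ> \<rho>) = mset lam" for \<pi>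
      by (simp only: permutes_conjugate_by_iff[OF assms] conjugate_by_comp[OF assms, symmetric]
          cycle_type_on_conjugate_by[OF assms])
    show "conjugate_by g ` {\<pi>. \<pi> permutes S \<and> cycle_type_on S (\<pi> \<circ> \<rho>) = mset lam} =
        {\<pi>. \<pi> permutes g ` S \<and> cycle_type_on (g ` S) (\<pi> \<circ> conjugate_by g \<rho>) = mset lam}"
    proof (intro set_eqI iffI)
      fix \<tau> assume "\<tau> \<in> {\<pi>. \<pi> permutes g ` S \<and> cycle_type_on (g ` S) (\<pi> \<circ> conjugate_by g \<rho>) = mset lam}"
      then show "\<tau> \<in> conjugate_by g ` {\<pi>. \<pi> permutes S \<and> cycle_type_on S (\<pi> \<circ> \<rho>) = mset lam}"
        using iff[of "conjugate_by (inv g) \<tau>"] unfolding conjugate_by_inv_cancel(2)[OF assms]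
        by (intro image_eqI[of _ _ "conjugate_by (inv g) \<tau>"])
          (simp_all only: mem_Collect_eq conjugate_by_inv_cancel(2)[OF assms])
    next
      fix \<tau> assume "\<tau> \<in> conjugate_by g ` {\<pi>. \<pi> permutes S \<and> cycle_type_on S (\<pi> \<circ> \<rho>) = mset lam}"
      then obtain \<pi> where "\<tau> = conjugate_by g \<pi>" "\<pi> permutes S \<and> cycle_type_on S (\<pi> \<circ> \<rho>) = mset lam"
        by (auto simp del: comp_apply)
      then show "\<tau> \<in> {\<pi>. \<pi> permutes g ` S \<and> cycle_type_on (g ` S) (\<pi> \<circ> conjugate_by g \<rho>) = mset lam}"
        using iff by simp
    qed
  qed
  show ?thesis
    unfolding cofactor_series_def sum.reindex_bij_betw[OF bij, symmetric]
    by (simp add: card_image_bij[OF assms] card_cycles_on_conjugate_by[OF assms])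
qed

text \<open>
  What is left of a Hurwitz tuple when its transpositions are multiplied together: \<open>\<rho>\<close> plays the role
  of \<open>\<rho>\<^sub>\<mu>\<close>, and \<open>\<rho>\<^sub>\<lambda>\<close> is the inverse of \<open>\<pi> \<circ> \<rho>\<close>, which has the same cycle type.
\<close>

definition hurwitz_pairs ::
  "nat \<Rightarrow> nat list \<Rightarrow> nat list \<Rightarrow> ((nat \<Rightarrow> nat) \<times> (nat \<Rightarrow> nat)) set" where
  "hurwitz_pairs d lam mu =
     (SIGMA \<rho>:{\<rho>. \<rho> permutes {1..d} \<and> cycle_type_on {1..d} \<rho> = mset mu}.
        {\<pi>. \<pi> permutes {1..d} \<and> cycle_type_on {1..d} (\<pi> \<circ> \<rho>) = mset lam})"

lemma finite_hurwitz_pairs: "finite (hurwitz_pairs d lam mu)"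
  unfolding hurwitz_pairs_def
  by (intro finite_SigmaI finite_subset[OF _ finite_permutations[of "{1..d}"]]) auto

lemma card_hurwitz_tuples:
  assumes "sum_list lam = d"
  shows "card (hurwitz_tuples k lam mu) =
    card {x \<in> hurwitz_pairs d lam mu. d - card (cycles_on {1..d} (snd x)) = k}"
proof (rule bij_betw_same_card)
  let ?D = "{1..d}" and ?smt = "strictly_monotone_transpositions d"
  let ?f = "\<lambda>(\<rho> :: nat \<Rightarrow> nat, ts, \<rho>' :: nat \<Rightarrow> nat). (\<rho>', comp_list ts :: nat \<Rightarrow> nat)"
  let ?T = "{x \<in> hurwitz_pairs d lam mu. d - card (cycles_on ?D (snd x)) = k}"
  have inv_type: "cycle_type_on ?D (inv p) = cycle_type_on ?D p" if "p permutes ?D" for p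
    unfolding cycle_type_on_def
    using cycles_on_inv[OF permutes_imp_permutation[OF finite_atLeastAtMost that]] by simp
  have mem: "(\<rho>, ts, \<rho>') \<in> hurwitz_tuples k lam mu \<longleftrightarrow>
      \<rho> permutes ?D \<and> cycle_type_on ?D \<rho> = mset lam \<and> \<rho>' permutes ?D \<and>
      cycle_type_on ?D \<rho>' = mset mu \<and> length ts = k \<and> ?smt ts \<and> \<rho> \<circ> comp_list ts \<circ> \<rho>' = id"
    for \<rho> ts \<rho>'
    unfolding hurwitz_tuples_def assms Let_def comp_list_def by simp
  have \<rho>: "\<rho> = inv (comp_list ts \<circ> \<rho>')"
    if "(\<rho>, ts, \<rho>') \<in> hurwitz_tuples k lam mu" for \<rho> ts \<rho>'
  proof -
    have p: "(comp_list ts \<circ> \<rho>') permutes ?D"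
      using that unfolding mem by (intro permutes_compose comp_list_strictly_monotone_permutes) auto
    have "\<rho> \<circ> (comp_list ts \<circ> \<rho>') = id" using that unfolding mem by (simp add: o_assoc)
    then have "\<rho> \<circ> (comp_list ts \<circ> \<rho>') \<circ> inv (comp_list ts \<circ> \<rho>') = inv (comp_list ts \<circ> \<rho>')" by simp
    then show ?thesis
      unfolding comp_assoc[of \<rho>] permutes_inv_o(1)[OF p] by simp
  qed
  show "bij_betw ?f (hurwitz_tuples k lam mu) ?T"
    unfolding bij_betw_def
  proof
    show "inj_on ?f (hurwitz_tuples k lam mu)"
    proof (rule inj_onI)
      fix x y assume x: "x \<in> hurwitz_tuples k lam mu" and y: "y \<in> hurwitz_tuples k lam mu"
        and eq: "?f x = ?f y"
      obtain \<rho>1 ts1 \<rho>1' where x_eq: "x = (\<rho>1, ts1, \<rho>1')" by (cases x) auto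
      obtain \<rho>2 ts2 \<rho>2' where y_eq: "y = (\<rho>2, ts2, \<rho>2')" by (cases y) auto
      have e: "\<rho>1' = \<rho>2'" "comp_list ts1 = comp_list ts2" using eq by (auto simp: x_eq y_eq)
      have s: "?smt ts1" "?smt ts2" using x y unfolding x_eq y_eq mem by auto
      have "ts1 = ts2" using ex1_strictly_monotone_factorisation[OF comp_list_strictly_monotone_permutes[OF s(1)]] s e(2) by metis
      then show "x = y" using e \<rho>[OF x[unfolded x_eq]] \<rho>[OF y[unfolded y_eq]]
        unfolding x_eq y_eq by simp
    qed
    show "?f ` hurwitz_tuples k lam mu = ?T"
    proof
      show "?f ` hurwitz_tuples k lam mu \<subseteq> ?T"
      proof (rule image_subsetI)
        fix x assume x: "x \<in> hurwitz_tuples k lam mu"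
        obtain \<rho>1 ts \<rho>' where x_eq: "x = (\<rho>1, ts, \<rho>')" by (cases x) auto
        note m = x[unfolded x_eq mem]
        have ts: "?smt ts" using m by blast
        have p: "(comp_list ts \<circ> \<rho>') permutes ?D"
          using m by (intro permutes_compose comp_list_strictly_monotone_permutes) auto
        have "cycle_type_on ?D (comp_list ts \<circ> \<rho>') = mset lam"
          using inv_type[OF p] \<rho>[OF x[unfolded x_eq]] m by simp
        moreover have "d - card (cycles_on ?D (comp_list ts)) = k"
          using length_strictly_monotone_factorisation[OF ts] m by linarith
        ultimately show "?f x \<in> ?T"
          using m comp_list_strictly_monotone_permutes[OF ts] by (simp add: x_eq hurwitz_pairs_def)
      qed
      show "?T \<subseteq> ?f ` hurwitz_tuples k lam mu"
      proof
        fix y assume y: "y \<in> ?T"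
        obtain \<rho>' \<pi> where y_eq: "y = (\<rho>', \<pi>)" by (cases y) auto
        have y': "\<rho>' permutes ?D" "cycle_type_on ?D \<rho>' = mset mu" "\<pi> permutes ?D"
          "cycle_type_on ?D (\<pi> \<circ> \<rho>') = mset lam" "d - card (cycles_on ?D \<pi>) = k"
          using y unfolding y_eq hurwitz_pairs_def by auto
        obtain ts where ts: "?smt ts" "comp_list ts = \<pi>" using ex1_strictly_monotone_factorisation[OF y'(3)] by blast
        have p: "(\<pi> \<circ> \<rho>') permutes ?D" by (intro permutes_compose y')
        have "(inv (\<pi> \<circ> \<rho>'), ts, \<rho>') \<in> hurwitz_tuples k lam mu"
          unfolding mem using y' ts length_strictly_monotone_factorisation[OF ts(1)] permutes_inv[OF p] inv_type[OF p]
            permutes_inv_o(2)[OF p]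
          by (auto simp only: comp_assoc)
        then show "y \<in> ?f ` hurwitz_tuples k lam mu"
          using ts(2) by (force simp: y_eq)
      qed
    qed
  qed
qed

lemma hurwitz_series_eq_sum:
  assumes "sum_list lam = d"
  shows "hurwitz_series lam mu = Poly_Mapping.single 0 (1 / fact d) *
    (\<Sum>\<rho> | \<rho> permutes {1..d} \<and> cycle_type_on {1..d} \<rho> = mset mu. cofactor_series {1..d} lam \<rho>)"
proof -
  let ?D = "{1..d}"
  define T where "T = hurwitz_pairs d lam mu"
  define g where "g x = d - card (cycles_on ?D (snd x))" for x :: "(nat \<Rightarrow> nat) \<times> (nat \<Rightarrow> nat)"
  define w :: "(nat \<Rightarrow> nat) \<times> (nat \<Rightarrow> nat) \<Rightarrow> laurent" where
    "w x = Poly_Mapping.single (int (g x)) 1" for x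
  have finT: "finite T" unfolding T_def by (rule finite_hurwitz_pairs)
  have num: "hurwitz_number k lam mu = of_nat (card {x \<in> T. g x = k}) / fact d" for k
    unfolding hurwitz_number_def card_hurwitz_tuples[OF assms] assms T_def g_def ..
  have coeff: "Poly_Mapping.single (int k) (hurwitz_number k lam mu) =
      Poly_Mapping.single 0 (1 / fact d) * (\<Sum>x\<in>{x \<in> T. g x = k}. w x)" for k
  proof -
    have "(\<Sum>x\<in>{x \<in> T. g x = k}. w x) = (\<Sum>x\<in>{x \<in> T. g x = k}. Poly_Mapping.single (int k) 1)"
      by (intro sum.cong) (auto simp: w_def)
    also have "\<dots> = Poly_Mapping.single (int k) (of_nat (card {x \<in> T. g x = k}))"
      by (simp add: mult_single flip: single_of_nat)
    finally show ?thesis by (simp add: num mult_single)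
  qed
  have "hurwitz_series lam mu = (\<Sum>k\<in>{..d}. Poly_Mapping.single (int k) (hurwitz_number k lam mu))"
    unfolding hurwitz_series_def
  proof (rule Sum_any.expand_superset)
    show "{k. Poly_Mapping.single (int k) (hurwitz_number k lam mu) \<noteq> 0} \<subseteq> {..d}"
    proof
      fix k assume "k \<in> {k. Poly_Mapping.single (int k) (hurwitz_number k lam mu) \<noteq> 0}"
      then have "{x \<in> T. g x = k} \<noteq> {}" unfolding num by (metis (mono_tags, lifting) card.empty div_0 mem_Collect_eq of_nat_0 single_zero)
      then show "k \<in> {..d}" by (auto simp: g_def)
    qed
  qed simp
  also have "\<dots> = Poly_Mapping.single 0 (1 / fact d) * (\<Sum>k\<in>{..d}. \<Sum>x\<in>{x \<in> T. g x = k}. w x)"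
    unfolding coeff by (rule sum_distrib_left[symmetric])
  also have "(\<Sum>k\<in>{..d}. \<Sum>x\<in>{x \<in> T. g x = k}. w x) = sum w T"
    by (rule sum.group) (auto simp: finT g_def)
  also have "sum w T = (\<Sum>\<rho> | \<rho> permutes ?D \<and> cycle_type_on ?D \<rho> = mset mu. cofactor_series ?D lam \<rho>)"
  proof -
    have "card (cycles_on ?D \<pi>) \<le> d" for \<pi> :: "nat \<Rightarrow> nat"
      unfolding cycles_on_def using card_image_le[of ?D "orbit \<pi>"] by simp
    then have w: "w (\<rho>, \<pi>) = Poly_Mapping.single (int (card ?D) - int (card (cycles_on ?D \<pi>))) 1" for \<rho> \<pi>
      by (simp add: w_def g_def of_nat_diff)
    have "sum w T = (\<Sum>(\<rho>, \<pi>)\<in>T. w (\<rho>, \<pi>))" by simp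
    also have "\<dots> = (\<Sum>\<rho> | \<rho> permutes ?D \<and> cycle_type_on ?D \<rho> = mset mu.
        \<Sum>\<pi> | \<pi> permutes ?D \<and> cycle_type_on ?D (\<pi> \<circ> \<rho>) = mset lam. w (\<rho>, \<pi>))"
      unfolding T_def hurwitz_pairs_def
      by (rule sum.Sigma[symmetric])
        (auto intro: finite_subset[OF _ finite_permutations[of ?D]])
    finally show ?thesis unfolding w cofactor_series_def .
  qed
  finally show ?thesis .
qed

text \<open>
  All permutations of type \<open>mu\<close> are conjugate, so they have the same cofactor series, and \<open>d!\<close>
  times that series is its sum over all conjugators. Grouping the conjugators by their result makes each
  permutation of type \<open>mu\<close> appear \<open>z(mu)\<close> times, by \<open>card_conjugators\<close>.
\<close>

lemma cofactor_series_eq_hurwitz_series: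
  fixes B :: "nat set"
  assumes "finite B" "sum_list lam = card B" "\<rho> permutes B" "cycle_type_on B \<rho> = mset mu"
  shows "cofactor_series B lam \<rho> = of_nat (zee mu) * hurwitz_series lam mu"
proof -
  define d where "d = card B"
  let ?D = "{1..d}"
  let ?class = "{\<rho>. \<rho> permutes ?D \<and> cycle_type_on ?D \<rho> = mset mu}"
  have "card B = card ?D" by (simp add: d_def)
  then obtain f where f: "bij_betw f B ?D"
    using assms(1) finite_same_card_bij by blast
  obtain g where g: "g permutes B \<union> ?D" "\<And>x. x \<in> B \<Longrightarrow> g x = f x"
    using extend_bij_betw[OF assms(1) _ f] by auto
  have bg: "bij g" using g(1) by (rule permutes_bij)
  have gB: "g ` B = ?D" using f g(2) by (simp add: bij_betw_def)
  define \<beta> where "\<beta> = conjugate_by g \<rho>"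
  have \<beta>: "\<beta> permutes ?D" "cycle_type_on ?D \<beta> = mset mu"
    using permutes_conjugate_by[OF bg assms(3)] cycle_type_on_conjugate_by[OF bg, of B \<rho>] assms(4)
    unfolding \<beta>_def gB by simp_all
  have "cofactor_series B lam \<rho> = cofactor_series ?D lam \<beta>"
    using cofactor_series_conjugate_by[OF bg, of B lam \<rho>] unfolding \<beta>_def gB by simp
  moreover have "of_nat (fact d) * cofactor_series ?D lam \<beta> =
      of_nat (zee mu) * (\<Sum>\<rho>\<in>?class. cofactor_series ?D lam \<rho>)"
  proof -
    have const: "cofactor_series ?D lam (conjugate_by h \<beta>) = cofactor_series ?D lam \<beta>"
      if "h permutes ?D" for h
      using cofactor_series_conjugate_by[OF permutes_bij[OF that], of ?D lam \<beta>]
      unfolding permutes_image[OF that] .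
    have "of_nat (fact d) * cofactor_series ?D lam \<beta> =
        (\<Sum>h | h permutes ?D. cofactor_series ?D lam (conjugate_by h \<beta>))"
      using const card_permutations[of ?D d] by simp
    also have "\<dots> = (\<Sum>\<rho>\<in>?class. \<Sum>h\<in>{h \<in> {h. h permutes ?D}. conjugate_by h \<beta> = \<rho>}.
        cofactor_series ?D lam (conjugate_by h \<beta>))"
    proof (rule sum.group[symmetric])
      show "finite {h. h permutes ?D}" by (rule finite_permutations) simp
      show "finite ?class" by (rule finite_subset[OF _ finite_permutations[of ?D]]) auto
      show "(\<lambda>h. conjugate_by h \<beta>) ` {h. h permutes ?D} \<subseteq> ?class"
      proof (rule image_subsetI)
        fix h assume "h \<in> {h. h permutes ?D}"
        then have h: "h permutes ?D" by simp
        show "conjugate_by h \<beta> \<in> ?class"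
          using permutes_conjugate_by[OF permutes_bij[OF h] \<beta>(1)]
            cycle_type_on_conjugate_by[OF permutes_bij[OF h], of ?D \<beta>] \<beta>(2)
          unfolding permutes_image[OF h] by simp
      qed
    qed
    also have "\<dots> = (\<Sum>\<rho>\<in>?class. of_nat (zee mu) * cofactor_series ?D lam \<rho>)"
    proof (rule sum.cong[OF refl])
      fix \<rho> assume "\<rho> \<in> ?class"
      then have "card {h. h permutes ?D \<and> conjugate_by h \<beta> = \<rho>} = zee mu"
        using card_conjugators[OF _ \<beta>(1) _ \<beta>(2), of \<rho>] by simp
      then show "(\<Sum>h\<in>{h \<in> {h. h permutes ?D}. conjugate_by h \<beta> = \<rho>}.
          cofactor_series ?D lam (conjugate_by h \<beta>)) = of_nat (zee mu) * cofactor_series ?D lam \<rho>"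
        by simp
    qed
    finally show ?thesis by (simp add: sum_distrib_left)
  qed
  moreover have "Poly_Mapping.single 0 (1 / fact d) * of_nat (fact d) = (1 :: laurent)"
    by (simp add: mult_single flip: single_of_nat)
  ultimately show ?thesis
    unfolding hurwitz_series_eq_sum[OF assms(2)[folded d_def]]
      mult.left_commute[of "of_nat (zee mu)"] by (metis mult.assoc mult_1)
qed

section \<open>Labelled hypermaps\<close>

definition relabel :: "('e \<Rightarrow> 'e) \<Rightarrow> 'e hypermap \<Rightarrow> 'e hypermap" where
  "relabel g M = \<lparr>edges = g ` edges M, sig0 = conjugate_by g (sig0 M),
     sig1 = conjugate_by g (sig1 M), sig2 = conjugate_by g (sig2 M), roots = map g (roots M)\<rparr>"

lemma relabel_sel [simp]:
  "edges (relabel g M) = g ` edges M"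
  "sig0 (relabel g M) = conjugate_by g (sig0 M)"
  "sig1 (relabel g M) = conjugate_by g (sig1 M)"
  "sig2 (relabel g M) = conjugate_by g (sig2 M)"
  "roots (relabel g M) = map g (roots M)"
  by (simp_all add: relabel_def)

lemma relabel_id [simp]: "relabel id M = M"
  by (simp add: relabel_def)

lemma relabel_relabel: "bij g \<Longrightarrow> bij h \<Longrightarrow> relabel h (relabel g M) = relabel (h \<circ> g) M"
  unfolding relabel_def by (simp add: conjugate_by_conjugate_by image_image)

lemma relabel_inv_cancel [simp]:
  "bij g \<Longrightarrow> relabel (inv g) (relabel g M) = M"
  "bij g \<Longrightarrow> relabel g (relabel (inv g) M) = M"
  by (simp_all add: relabel_relabel bij_imp_bij_inv bij_is_inj bij_is_surj surj_iff[THEN iffD1])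

lemma is_hypermap_relabel:
  assumes "bij g" "is_hypermap M"
  shows "is_hypermap (relabel g M)"
proof -
  have "conjugate_by g (sig0 M) \<circ> conjugate_by g (sig1 M) \<circ> conjugate_by g (sig2 M) = id"
    using assms by (simp add: conjugate_by_comp[symmetric] is_hypermap_def)
  then show ?thesis
    using assms inj_on_image_bij[OF assms(1), of UNIV] unfolding is_hypermap_def
    by (auto simp: permutes_conjugate_by_iff orbit_conjugate_by inj_eq)
qed

lemma hypermap_iso_relabel: "bij g \<Longrightarrow> hypermap_iso g M (relabel g M)"
  by (auto simp: hypermap_iso_def conjugate_by_apply bij_is_inj inj_on_subset[of g UNIV] intro!: bij_betw_imageI)

lemma hypermap_iso_imp_relabel:
  assumes "is_hypermap M" "is_hypermap N" "hypermap_iso \<phi> M N" "bij g"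
    and g: "\<And>x. x \<in> edges M \<Longrightarrow> g x = \<phi> x"
  shows "N = relabel g M"
proof -
  have im: "g ` edges M = edges N"
    using assms(3) g by (simp add: hypermap_iso_def bij_betw_def)
  have conj: "q = conjugate_by g p"
    if p: "p permutes edges M" and q: "q permutes edges N"
      and eq: "\<forall>x\<in>edges M. \<phi> (p x) = q (\<phi> x)" for p q
  proof (rule conjugate_by_eqI[OF assms(4)])
    fix x show "q (g x) = g (p x)"
    proof (cases "x \<in> edges M")
      case True
      then show ?thesis using eq g permutes_in_image[OF p] by simp
    next
      case False
      then have "g x \<notin> edges N" using im assms(4) by (metis bij_is_inj inj_image_mem_iff)
      then show ?thesis using False permutes_not_in[OF p] permutes_not_in[OF q] by simp
    qed
  qed
  have "map g (roots M) = roots N"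
  proof -
    have "map g (roots M) = map \<phi> (roots M)"
      using assms(1) g by (intro map_cong refl) (auto simp: is_hypermap_def)
    also have "\<dots> = roots N" using assms(3) by (simp add: hypermap_iso_def)
    finally show ?thesis .
  qed
  moreover have "sig0 N = conjugate_by g (sig0 M)" "sig1 N = conjugate_by g (sig1 M)"
    "sig2 N = conjugate_by g (sig2 M)"
    using assms(1-3) by (auto simp: is_hypermap_def hypermap_iso_def intro!: conj)
  ultimately show ?thesis using im by (intro hypermap.equality) simp_all
qed

text \<open>
  Equivalence becomes the orbit relation of a group acting on hypermaps, which is what the counting
  of classes needs.
\<close>

lemma hypermap_equiv_iff_relabel:
  assumes "is_hypermap M"
  shows "(M, N) \<in> hypermap_equiv \<longleftrightarrow> (\<exists>g. bij g \<and> N = relabel g M)"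
proof
  assume "(M, N) \<in> hypermap_equiv"
  then obtain \<phi> where N: "is_hypermap N" and \<phi>: "hypermap_iso \<phi> M N"
    by (auto simp: hypermap_equiv_def)
  have "finite (edges M)" "finite (edges N)" "bij_betw \<phi> (edges M) (edges N)"
    using assms N \<phi> by (auto simp: is_hypermap_def hypermap_iso_def)
  from extend_bij_betw[OF this] obtain g where "g permutes edges M \<union> edges N"
    "\<And>x. x \<in> edges M \<Longrightarrow> g x = \<phi> x" by blast
  then show "\<exists>g. bij g \<and> N = relabel g M"
    using hypermap_iso_imp_relabel[OF assms N \<phi>] permutes_bij by blast
next
  assume "\<exists>g. bij g \<and> N = relabel g M"
  then show "(M, N) \<in> hypermap_equiv"
    using assms is_hypermap_relabel hypermap_iso_relabel unfolding hypermap_equiv_def by blast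
qed

lemma equiv_hypermap_equiv: "equiv (Collect is_hypermap) (hypermap_equiv :: ('e hypermap \<times> 'e hypermap) set)"
proof (rule equivI)
  show "hypermap_equiv \<subseteq> Collect is_hypermap \<times> (Collect is_hypermap :: 'e hypermap set)"
    by (auto simp: hypermap_equiv_def)
  show "refl_on (Collect is_hypermap) (hypermap_equiv :: ('e hypermap \<times> 'e hypermap) set)"
    by (auto simp: refl_on_def hypermap_equiv_iff_relabel intro!: exI[of _ id])
  show "sym (hypermap_equiv :: ('e hypermap \<times> 'e hypermap) set)"
  proof (rule symI)
    fix M N :: "'e hypermap" assume a: "(M, N) \<in> hypermap_equiv"
    then have "is_hypermap M" "is_hypermap N" by (auto simp: hypermap_equiv_def)
    with a show "(N, M) \<in> hypermap_equiv"
      by (metis hypermap_equiv_iff_relabel relabel_inv_cancel(1) bij_imp_bij_inv)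
  qed
  show "trans (hypermap_equiv :: ('e hypermap \<times> 'e hypermap) set)"
  proof (rule transI)
    fix K M N :: "'e hypermap" assume a: "(K, M) \<in> hypermap_equiv" "(M, N) \<in> hypermap_equiv"
    then have "is_hypermap K" "is_hypermap M" by (auto simp: hypermap_equiv_def)
    with a show "(K, N) \<in> hypermap_equiv"
      by (metis hypermap_equiv_iff_relabel relabel_relabel bij_comp)
  qed
qed

subsection \<open>Invariance of the counted quantities\<close>

lemma vertices_relabel: "bij g \<Longrightarrow> vertices (relabel g M) = (`) g ` vertices M"
  by (simp add: vertices_def cycles_on_conjugate_by)

lemma hyperedges_relabel: "bij g \<Longrightarrow> hyperedges (relabel g M) = (`) g ` hyperedges M"
  by (simp add: hyperedges_def cycles_on_conjugate_by)

lemma boundary_faces_relabel: "bij g \<Longrightarrow> boundary_faces (relabel g M) = map ((`) g) (boundary_faces M)"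
  by (simp add: boundary_faces_def orbit_conjugate_by)

lemma internal_faces_relabel: "bij g \<Longrightarrow> internal_faces (relabel g M) = (`) g ` internal_faces M"
  by (simp add: internal_faces_def blue_faces_def boundary_faces_relabel cycles_on_conjugate_by
      image_set_diff[OF inj_on_image_bij[of g UNIV]])

lemma boundary_edges_relabel: "bij g \<Longrightarrow> boundary_edges (relabel g M) = g ` boundary_edges M"
  by (auto simp: boundary_edges_def boundary_faces_relabel)

lemma euler_char_relabel: "bij g \<Longrightarrow> euler_char (relabel g M) = euler_char M"
  by (simp add: euler_char_def vertices_relabel hyperedges_relabel internal_faces_relabel
      card_image inj_on_image_bij card_image_bij)

lemma fully_simple_relabel: "bij g \<Longrightarrow> fully_simple (relabel g M) \<longleftrightarrow> fully_simple M"
  by (simp add: fully_simple_def vertices_relabel boundary_edges_relabel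
      image_Int[OF bij_is_inj, symmetric] card_image_bij)

lemma card_filter_card_image:
  assumes "bij g" shows "card {c \<in> (`) g ` X. card c = i} = card {c \<in> X. card c = i}"
proof -
  have "{c \<in> (`) g ` X. card c = i} = (`) g ` {c \<in> X. card c = i}"
    by (auto simp: card_image_bij[OF assms])
  then show ?thesis by (simp add: card_image inj_on_image_bij[OF assms])
qed

lemma has_monomial_relabel: "bij g \<Longrightarrow> has_monomial (relabel g M) a b \<longleftrightarrow> has_monomial M a b"
  by (simp add: has_monomial_def hyperedges_relabel internal_faces_relabel card_filter_card_image)

lemma map_card_boundary_faces_relabel:
  "bij g \<Longrightarrow> map card (boundary_faces (relabel g M)) = map card (boundary_faces M)"
  by (simp add: boundary_faces_relabel card_image_bij)

lemma automorphisms_eq: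
  assumes "is_hypermap M"
  shows "automorphisms M = {\<phi>. \<phi> permutes edges M \<and> relabel \<phi> M = M}"
  using hypermap_iso_imp_relabel[OF assms assms] hypermap_iso_relabel[of _ M] permutes_bij
  unfolding automorphisms_def by (metis (no_types, lifting))

lemma card_automorphisms_relabel:
  assumes "bij g" "is_hypermap M"
  shows "card (automorphisms (relabel g M)) = card (automorphisms M)"
proof -
  have aux: "conjugate_by h \<phi> \<in> automorphisms (relabel h N)"
    if "bij h" "is_hypermap N" "\<phi> \<in> automorphisms N" for h \<phi> and N :: "'a hypermap"
  proof -
    have \<phi>: "\<phi> permutes edges N" "relabel \<phi> N = N"
      using that automorphisms_eq by blast+
    have "relabel (conjugate_by h \<phi>) (relabel h N) = relabel (conjugate_by h \<phi> \<circ> h) N"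
      using that(1) \<phi>(1) by (simp add: relabel_relabel bij_conjugate_by permutes_bij)
    also have "conjugate_by h \<phi> \<circ> h = h \<circ> \<phi>"
      using that(1) by (auto simp: conjugate_by_apply)
    also have "relabel (h \<circ> \<phi>) N = relabel h N"
      using that(1) \<phi> by (metis relabel_relabel permutes_bij)
    finally show ?thesis
      using that \<phi>(1) by (simp add: automorphisms_eq is_hypermap_relabel permutes_conjugate_by)
  qed
  have "automorphisms (relabel g M) = conjugate_by g ` automorphisms M"
  proof
    show "conjugate_by g ` automorphisms M \<subseteq> automorphisms (relabel g M)"
      using aux[OF assms] by blast
    show "automorphisms (relabel g M) \<subseteq> conjugate_by g ` automorphisms M"
    proof
      fix \<psi> assume \<psi>: "\<psi> \<in> automorphisms (relabel g M)"
      have "conjugate_by (inv g) \<psi> \<in> automorphisms M"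
        using aux[OF bij_imp_bij_inv[OF assms(1)] is_hypermap_relabel[OF assms] \<psi>] assms(1) by simp
      then show "\<psi> \<in> conjugate_by g ` automorphisms M"
        using assms(1) by (intro image_eqI[of _ _ "conjugate_by (inv g) \<psi>"]) simp_all
    qed
  qed
  then show ?thesis by (simp add: card_image inj_conjugate_by[OF assms(1)])
qed

lemma hweight_relabel:
  "bij g \<Longrightarrow> is_hypermap M \<Longrightarrow> hweight (relabel g M) = hweight M"
  by (simp add: hweight_def euler_char_relabel card_automorphisms_relabel)

subsection \<open>Classes as orbits of the symmetric group\<close>

text \<open>
  Orbit and stabilizer for the symmetric group of \<open>V\<close> acting by relabelling.
\<close>

lemma card_relabellings:
  assumes "is_hypermap M" "edges M = V"
  shows "card ((\<lambda>h. relabel h M) ` {h. h permutes V}) * card (automorphisms M) = fact (card V)"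
proof -
  let ?G = "{h. h permutes V}" and ?O = "(\<lambda>h. relabel h M) ` {h. h permutes V}"
  have fin: "finite V" using assms by (auto simp: is_hypermap_def)
  have finG: "finite ?G" using finite_permutations[OF fin] .
  have fibre: "card {h \<in> ?G. relabel h M = N} = card (automorphisms M)" if N: "N \<in> ?O" for N
  proof -
    obtain k where k: "k permutes V" "N = relabel k M" using N by blast
    have "bij_betw ((\<circ>) k) (automorphisms M) {h \<in> ?G. relabel h M = N}"
    proof (rule bij_betw_byWitness[where f' = "(\<circ>) (inv k)"])
      show "\<forall>\<phi>\<in>automorphisms M. inv k \<circ> (k \<circ> \<phi>) = \<phi>"
        "\<forall>h\<in>{h \<in> ?G. relabel h M = N}. k \<circ> (inv k \<circ> h) = h"
        by (simp_all add: o_assoc permutes_inv_o[OF k(1)])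
      show "(\<circ>) k ` automorphisms M \<subseteq> {h \<in> ?G. relabel h M = N}"
      proof (rule image_subsetI)
        fix \<phi> assume "\<phi> \<in> automorphisms M"
        then have "\<phi> permutes V" "relabel \<phi> M = M"
          using automorphisms_eq[OF assms(1)] assms(2) by auto
        then show "k \<circ> \<phi> \<in> {h \<in> ?G. relabel h M = N}"
          using k by (simp add: permutes_compose relabel_relabel[OF permutes_bij permutes_bij, symmetric])
      qed
      show "(\<circ>) (inv k) ` {h \<in> ?G. relabel h M = N} \<subseteq> automorphisms M"
      proof (rule image_subsetI)
        fix h assume "h \<in> {h \<in> ?G. relabel h M = N}"
        then have h: "h permutes V" "relabel h M = relabel k M" using k by auto
        have "relabel (inv k \<circ> h) M = M"
          using h k(1) by (simp add: relabel_relabel[OF permutes_bij permutes_bij[OF permutes_inv], symmetric] permutes_bij)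
        then show "inv k \<circ> h \<in> automorphisms M"
          using h(1) k(1) by (simp add: automorphisms_eq[OF assms(1)] assms(2) permutes_compose permutes_inv)
      qed
    qed
    then show ?thesis by (simp add: bij_betw_same_card)
  qed
  have "fact (card V) = (\<Sum>h\<in>?G. 1 :: nat)" using card_permutations[OF refl fin] by simp
  also have "\<dots> = (\<Sum>N\<in>?O. \<Sum>h\<in>{h \<in> ?G. relabel h M = N}. 1)"
    using finG by (intro sum.group[symmetric]) auto
  also have "\<dots> = (\<Sum>N\<in>?O. card (automorphisms M))"
    using fibre by (intro sum.cong) simp_all
  finally show ?thesis by simp
qed

text \<open>
  Every class contains hypermaps with the edge set \<open>{..<N}\<close>, and by \<open>card_relabellings\<close> there are
  \<open>N! / card Aut\<close> of them, which compensates the automorphisms in the weight.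
\<close>

lemma sum_hweight_classes:
  fixes Q :: "nat hypermap \<Rightarrow> bool"
  assumes inv: "\<And>g M. bij g \<Longrightarrow> is_hypermap M \<Longrightarrow> Q M \<Longrightarrow> Q (relabel g M)"
    and size: "\<And>M. is_hypermap M \<Longrightarrow> Q M \<Longrightarrow> card (edges M) = N"
    and fin: "finite {M. is_hypermap M \<and> Q M \<and> edges M = {..<N}}"
  shows "of_nat (fact N) * (\<Sum>C \<in> {M. is_hypermap M \<and> Q M} // hypermap_equiv. hweight (SOME M. M \<in> C)) =
    (\<Sum>M | is_hypermap M \<and> Q M \<and> edges M = {..<N}. Poly_Mapping.single (- euler_char M) 1)"
proof -
  let ?V = "{..<N}"
  let ?X = "{M. is_hypermap M \<and> Q M}"
  define L where "L = {M. is_hypermap M \<and> Q M \<and> edges M = ?V}"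
  define cl where "cl M = hypermap_equiv `` {M}" for M :: "nat hypermap"
  define w :: "nat hypermap \<Rightarrow> laurent" where "w M = Poly_Mapping.single (- euler_char M) 1" for M
  have cl_eq: "cl M = cl M' \<longleftrightarrow> (M, M') \<in> hypermap_equiv" if "is_hypermap M" "is_hypermap M'" for M M'
    unfolding cl_def using eq_equiv_class_iff[OF equiv_hypermap_equiv] that by auto
  have quot: "?X // hypermap_equiv = cl ` L"
  proof
    show "cl ` L \<subseteq> ?X // hypermap_equiv" by (auto simp: L_def cl_def intro: quotientI)
    show "?X // hypermap_equiv \<subseteq> cl ` L"
    proof
      fix C assume "C \<in> ?X // hypermap_equiv"
      then obtain M where M: "is_hypermap M" "Q M" "C = cl M"
        by (auto simp: quotient_def cl_def)
      have finM: "finite (edges M)" using M(1) by (simp add: is_hypermap_def)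
      obtain f where f: "bij_betw f (edges M) ?V"
        using finite_same_card_bij[OF finM finite_lessThan] size[OF M(1,2)] by auto
      obtain g where g: "g permutes edges M \<union> ?V" "\<And>x. x \<in> edges M \<Longrightarrow> g x = f x"
        using extend_bij_betw[OF finM _ f] by auto
      have bg: "bij g" using permutes_bij[OF g(1)] .
      have "g ` edges M = ?V" using f g(2) by (simp add: bij_betw_def)
      then have "relabel g M \<in> L"
        using M inv[OF bg M(1,2)] is_hypermap_relabel[OF bg M(1)] by (simp add: L_def)
      moreover have "cl M = cl (relabel g M)"
        using cl_eq[OF M(1) is_hypermap_relabel[OF bg M(1)]] hypermap_equiv_iff_relabel[OF M(1)] bg by blast
      ultimately show "C \<in> cl ` L" using M(3) by blast
    qed
  qed
  have weight_class: "of_nat (fact N) * hweight (SOME M. M \<in> C) = (\<Sum>M\<in>{M \<in> L. cl M = C}. w M)"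
    if C: "C \<in> cl ` L" for C
  proof -
    obtain M where M: "M \<in> L" "C = cl M" using C by blast
    then have hM: "is_hypermap M" "Q M" "edges M = ?V" by (auto simp: L_def)
    have "M \<in> C" using M(2) hM(1) by (auto simp: cl_def hypermap_equiv_iff_relabel intro!: exI[of _ id])
    then have "(SOME M. M \<in> C) \<in> C" by (rule someI)
    then obtain g where "bij g" "(SOME M. M \<in> C) = relabel g M"
      using M(2) hM(1) by (auto simp: cl_def hypermap_equiv_iff_relabel)
    then have hw: "hweight (SOME M. M \<in> C) = hweight M" using hweight_relabel hM(1) by simp
    let ?O = "(\<lambda>h. relabel h M) ` {h. h permutes ?V}"
    have O: "{K \<in> L. cl K = C} = ?O"
    proof
      show "?O \<subseteq> {K \<in> L. cl K = C}"
      proof (rule image_subsetI)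
        fix h assume "h \<in> {h. h permutes ?V}"
        then have h: "h permutes ?V" and bh: "bij h" by (auto intro: permutes_bij)
        have "relabel h M \<in> L"
          using inv[OF bh hM(1,2)] is_hypermap_relabel[OF bh hM(1)] hM(3) permutes_image[OF h]
          by (simp add: L_def)
        moreover have "cl M = cl (relabel h M)"
          using cl_eq[OF hM(1) is_hypermap_relabel[OF bh hM(1)]] hypermap_equiv_iff_relabel[OF hM(1)] bh by blast
        ultimately show "relabel h M \<in> {K \<in> L. cl K = C}" using M(2) by simp
      qed
      show "{K \<in> L. cl K = C} \<subseteq> ?O"
      proof
        fix K assume "K \<in> {K \<in> L. cl K = C}"
        then have K: "is_hypermap K" "edges K = ?V" "cl M = cl K" using M(2) by (auto simp: L_def)
        then obtain \<phi> where \<phi>: "hypermap_iso \<phi> M K"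
          using cl_eq[OF hM(1) K(1)] by (auto simp: hypermap_equiv_def)
        then have "bij_betw \<phi> ?V ?V" using hM(3) K(2) by (simp add: hypermap_iso_def)
        from extend_bij_betw[OF _ _ this] obtain h where h: "h permutes ?V"
          "\<And>x. x \<in> ?V \<Longrightarrow> h x = \<phi> x" by auto
        then have "K = relabel h M"
          using hypermap_iso_imp_relabel[OF hM(1) K(1) \<phi> permutes_bij[OF h(1)]] hM(3) by simp
        then show "K \<in> ?O" using h(1) by blast
      qed
    qed
    have wO: "w K = w M" if "K \<in> ?O" for K
      using that by (auto simp: w_def euler_char_relabel dest!: permutes_bij)
    have cO: "card ?O * card (automorphisms M) = fact N"
      using card_relabellings[OF hM(1,3)] by simp
    then have "(of_nat (card ?O) :: rat) * of_nat (card (automorphisms M)) = fact N"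
      by (metis of_nat_fact of_nat_mult)
    moreover have "(of_nat (card (automorphisms M)) :: rat) \<noteq> 0"
      using cO by (metis fact_nonzero mult_0_right of_nat_eq_0_iff)
    ultimately have q: "of_nat (card ?O) = (fact N :: rat) / of_nat (card (automorphisms M))"
      by (simp add: field_simps)
    have "(\<Sum>K\<in>{K \<in> L. cl K = C}. w K) = of_nat (card ?O) * w M"
      unfolding O using wO by simp
    also have "\<dots> = Poly_Mapping.single (- euler_char M) (of_nat (card ?O))"
      by (simp add: w_def mult_single flip: single_of_nat)
    also have "\<dots> = of_nat (fact N) * hweight M"
      unfolding q by (simp add: hweight_def mult_single flip: single_of_nat)
    finally show ?thesis unfolding hw by simp
  qed
  have "of_nat (fact N) * (\<Sum>C \<in> ?X // hypermap_equiv. hweight (SOME M. M \<in> C)) =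
      (\<Sum>C\<in>cl ` L. \<Sum>M\<in>{M \<in> L. cl M = C}. w M)"
    unfolding quot sum_distrib_left using weight_class by (intro sum.cong) simp_all
  also have "\<dots> = sum w L"
    using fin by (intro sum.group) (simp_all add: L_def)
  finally show ?thesis unfolding w_def L_def .
qed

section \<open>Forgetting the positions of the roots\<close>

text \<open>
  Labelled hypermaps in which the boundary is only marked as a set of edges \<open>B\<close>, with no choice of
  roots. The condition on \<open>s2\<close> says that \<open>B\<close> is a union of blue faces.
\<close>

definition configurations ::
  "'e set \<Rightarrow> (nat \<Rightarrow>\<^sub>0 nat) \<Rightarrow> (nat \<Rightarrow>\<^sub>0 nat) \<Rightarrow>
   (('e \<Rightarrow> 'e) \<times> ('e \<Rightarrow> 'e) \<times> ('e \<Rightarrow> 'e) \<times> 'e set) set" where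
  "configurations V a b =
     {(s0, s1, s2, B). s0 permutes V \<and> s1 permutes V \<and> s2 permutes V \<and> s0 \<circ> s1 \<circ> s2 = id \<and>
        B \<subseteq> V \<and> s2 ` B = B \<and>
        (\<forall>i. Poly_Mapping.lookup a i = card {f \<in> cycles_on (V - B) s2. card f = i}) \<and>
        (\<forall>i. Poly_Mapping.lookup b i = card {h \<in> cycles_on V s1. card h = i})}"

fun boundary_type :: "('e \<Rightarrow> 'e) \<times> ('e \<Rightarrow> 'e) \<times> ('e \<Rightarrow> 'e) \<times> 'e set \<Rightarrow> nat multiset" where
  "boundary_type (s0, s1, s2, B) = cycle_type_on B s2"

fun simple_boundary :: "('e \<Rightarrow> 'e) \<times> ('e \<Rightarrow> 'e) \<times> ('e \<Rightarrow> 'e) \<times> 'e set \<Rightarrow> bool" where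
  "simple_boundary (s0, s1, s2, B) \<longleftrightarrow> separates s0 B"

fun euler_weight :: "'e set \<Rightarrow> ('e \<Rightarrow> 'e) \<times> ('e \<Rightarrow> 'e) \<times> ('e \<Rightarrow> 'e) \<times> 'e set \<Rightarrow> laurent" where
  "euler_weight V (s0, s1, s2, B) = Poly_Mapping.single
     (int (card V) - int (card (cycles_on V s0)) - int (card (cycles_on V s1))
        - int (card (cycles_on (V - B) s2))) 1"

lemma finite_configurations:
  assumes "finite V" shows "finite (configurations V a b)"
proof (rule finite_subset)
  show "configurations V a b \<subseteq> {p. p permutes V} \<times> {p. p permutes V} \<times> {p. p permutes V} \<times> Pow V"
    by (auto simp: configurations_def)
  show "finite ({p. p permutes V} \<times> {p. p permutes V} \<times> {p. p permutes V} \<times> Pow V)"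
    using assms by (intro finite_cartesian_product finite_permutations) simp_all
qed

lemma cycles_on_Diff_closed:
  assumes "permutation p" "\<And>x. x \<in> B \<Longrightarrow> p x \<in> B"
  shows "cycles_on V p - cycles_on B p = cycles_on (V - B) p"
proof -
  have "orbit p x \<in> cycles_on B p \<longleftrightarrow> x \<in> B" for x
  proof
    assume "orbit p x \<in> cycles_on B p"
    then have "x \<in> \<Union>(cycles_on B p)" using permutation_self_in_orbit[OF assms(1), of x] by blast
    then show "x \<in> B" using Union_cycles_on[OF assms] by simp
  qed (simp add: cycles_on_def)
  then show ?thesis unfolding cycles_on_def[of V] cycles_on_def[of "V - B"] by blast
qed

context
  fixes M :: "'e hypermap"
  assumes hypermap: "is_hypermap M"
begin

lemma permutation_sig2: "permutation (sig2 M)"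
  using hypermap by (auto simp: is_hypermap_def intro: permutes_imp_permutation)

lemma distinct_boundary_faces: "distinct (boundary_faces M)"
  using hypermap by (simp add: is_hypermap_def boundary_faces_def distinct_conv_nth)

lemma sig2_boundary_edges: "x \<in> boundary_edges M \<Longrightarrow> sig2 M x \<in> boundary_edges M"
  by (auto simp: boundary_edges_def boundary_faces_def intro: orbit.step)

lemma boundary_edges_subset: "boundary_edges M \<subseteq> edges M"
proof -
  have "orbit (sig2 M) r \<subseteq> edges M" if "r \<in> set (roots M)" for r
    using that hypermap permutes_orbit_subset[of "sig2 M" "edges M" r] by (auto simp: is_hypermap_def)
  then show ?thesis by (auto simp: boundary_edges_def boundary_faces_def)
qed

lemma cycles_on_boundary_edges: "cycles_on (boundary_edges M) (sig2 M) = set (boundary_faces M)"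
proof
  show "cycles_on (boundary_edges M) (sig2 M) \<subseteq> set (boundary_faces M)"
    using orbit_eq_if_mem[OF permutation_sig2]
    by (fastforce simp: cycles_on_def boundary_edges_def boundary_faces_def)
  show "set (boundary_faces M) \<subseteq> cycles_on (boundary_edges M) (sig2 M)"
    using permutation_self_in_orbit[OF permutation_sig2]
    by (fastforce simp: cycles_on_def boundary_edges_def boundary_faces_def)
qed

lemma cycle_type_on_boundary_edges:
  "cycle_type_on (boundary_edges M) (sig2 M) = mset (map card (boundary_faces M))"
  using distinct_boundary_faces
  by (simp add: cycle_type_on_def cycles_on_boundary_edges mset_set_set)

lemma internal_faces_eq: "internal_faces M = cycles_on (edges M - boundary_edges M) (sig2 M)"
  unfolding internal_faces_def blue_faces_def cycles_on_boundary_edges[symmetric]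
  by (rule cycles_on_Diff_closed[OF permutation_sig2 sig2_boundary_edges])

lemma fully_simple_iff_separates: "fully_simple M \<longleftrightarrow> separates (sig0 M) (boundary_edges M)"
proof -
  have p: "permutation (sig0 M)" and fin: "finite (edges M)"
    using hypermap by (auto simp: is_hypermap_def intro: permutes_imp_permutation)
  let ?B = "boundary_edges M"
  have finB: "finite ?B" using boundary_edges_subset fin finite_subset by blast
  show ?thesis
  proof
    assume fs: "fully_simple M"
    show "separates (sig0 M) ?B"
      unfolding separates_def
    proof
      fix b assume b: "b \<in> ?B"
      have self: "b \<in> orbit (sig0 M) b" by (rule permutation_self_in_orbit[OF p])
      have "orbit (sig0 M) b \<in> vertices M"
        using b boundary_edges_subset by (auto simp: vertices_def cycles_on_def)
      then have "card (orbit (sig0 M) b \<inter> ?B) \<le> 1" using fs by (simp add: fully_simple_def)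
      then have "\<forall>x\<in>orbit (sig0 M) b \<inter> ?B. \<forall>y\<in>orbit (sig0 M) b \<inter> ?B. x = y"
        using finB by (simp add: card_le_Suc0_iff_eq)
      then show "orbit (sig0 M) b \<inter> ?B = {b}" using b self by blast
    qed
  next
    assume sep: "separates (sig0 M) ?B"
    show "fully_simple M"
      unfolding fully_simple_def
    proof
      fix v assume "v \<in> vertices M"
      then obtain x where v: "v = orbit (sig0 M) x" by (auto simp: vertices_def cycles_on_def)
      show "card (v \<inter> ?B) \<le> 1"
      proof (cases "v \<inter> ?B = {}")
        case False
        then obtain y where y: "y \<in> v" "y \<in> ?B" by blast
        then have "v = orbit (sig0 M) y" using v orbit_eq_if_mem[OF p] by blast
        then have "v \<inter> ?B = {y}" using sep y(2) by (simp add: separates_def)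
        then show ?thesis by simp
      qed simp
    qed
  qed
qed

text \<open>
  Each edge lies on exactly one blue face, and the internal ones are counted by the monomial in the \<open>t\<^sub>i\<close>.
  The number of edges is thus fixed in each coefficient, so all classes are labelled by the same set.
\<close>

lemma card_edges_eq:
  assumes "map card (boundary_faces M) = mu" "has_monomial M a b"
  shows "card (edges M) = sum_list mu + (\<Sum>i\<in>Poly_Mapping.keys a. i * Poly_Mapping.lookup a i)"
proof -
  have fin: "finite (edges M)" and p: "sig2 M permutes edges M"
    using hypermap by (auto simp: is_hypermap_def)
  have finB: "finite (blue_faces M)" unfolding blue_faces_def by (rule finite_cycles_on[OF fin])
  have sub: "set (boundary_faces M) \<subseteq> blue_faces M"
    using hypermap by (auto simp: blue_faces_def boundary_faces_def cycles_on_def is_hypermap_def)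
  have finI: "finite (internal_faces M)" using finB by (simp add: internal_faces_def)
  have "card (edges M) = (\<Sum>c\<in>blue_faces M. card c)"
    unfolding blue_faces_def
    using sum_card_cycles_on[OF fin permutation_sig2] permutes_in_image[OF p] by simp
  also have "\<dots> = (\<Sum>c\<in>internal_faces M. card c) + (\<Sum>c\<in>set (boundary_faces M). card c)"
    unfolding internal_faces_def by (rule sum.subset_diff[OF sub finB])
  also have "(\<Sum>c\<in>set (boundary_faces M). card c) = sum_list mu"
    using distinct_boundary_faces assms(1) by (metis sum_list_distinct_conv_sum_set)
  also have "(\<Sum>c\<in>internal_faces M. card c) =
      (\<Sum>i\<in>Poly_Mapping.keys a. \<Sum>c\<in>{c \<in> internal_faces M. card c = i}. card c)"
  proof (rule sum.group[symmetric])
    show "card ` internal_faces M \<subseteq> Poly_Mapping.keys a"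
    proof (rule image_subsetI)
      fix c assume "c \<in> internal_faces M"
      then have "{f \<in> internal_faces M. card f = card c} \<noteq> {}" by blast
      then have "Poly_Mapping.lookup a (card c) \<noteq> 0"
        using assms(2) finI by (simp add: has_monomial_def)
      then show "card c \<in> Poly_Mapping.keys a" by (simp add: in_keys_iff)
    qed
  qed (use finI in simp_all)
  also have "\<dots> = (\<Sum>i\<in>Poly_Mapping.keys a. i * Poly_Mapping.lookup a i)"
    using assms(2) by (intro sum.cong) (simp_all add: has_monomial_def)
  finally show ?thesis by simp
qed

end

text \<open>
  A rooted labelled hypermap is a configuration together with a root list of \<open>s2\<close> on \<open>B\<close>, and the
  weight does not depend on the latter. The predicate \<open>Q\<close> makes the lemma serve both
  ordinary and fully simple hypermaps.
\<close>

lemma sum_labelled_hypermaps: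
  fixes V :: "'e set"
  assumes fin: "finite V"
  shows "finite {M. is_hypermap M \<and> edges M = V \<and> map card (boundary_faces M) = mu \<and> has_monomial M a b \<and>
            Q (sig0 M) (boundary_edges M)}" (is "finite ?L")
    and "(\<Sum>M | is_hypermap M \<and> edges M = V \<and> map card (boundary_faces M) = mu \<and> has_monomial M a b \<and>
            Q (sig0 M) (boundary_edges M). Poly_Mapping.single (- euler_char M) 1) =
      of_nat (zee mu) * (\<Sum>x | x \<in> configurations V a b \<and> boundary_type x = mset mu \<and>
            (case x of (s0, s1, s2, B) \<Rightarrow> Q s0 B). euler_weight V x)" (is "?sum = ?rhs")
proof -
  define C where "C = {x. x \<in> configurations V a b \<and> boundary_type x = mset mu \<and>
            (case x of (s0, s1, s2, B) \<Rightarrow> Q s0 B)}"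
  define RL where "RL x = (case x of (s0 :: 'e \<Rightarrow> 'e, s1 :: 'e \<Rightarrow> 'e, s2 :: 'e \<Rightarrow> 'e, B) \<Rightarrow> root_lists B s2 mu)" for x
  \<comment> \<open>The set \<open>B\<close> is forgotten here, but it is recovered as the union of the orbits of the roots.\<close>
  define mk where "mk = (\<lambda>((s0, s1, s2, B :: 'e set), R).
    \<lparr>edges = V, sig0 = s0, sig1 = s1, sig2 = s2, roots = R\<rparr>)"
  have cov: "\<Union>(orbit s2 ` set R) = B"
    if "(s0, s1, s2, B) \<in> C" "R \<in> RL (s0, s1, s2, B)" for s0 s1 s2 B R
  proof -
    have x: "s2 permutes V" "B \<subseteq> V" "s2 ` B = B" "cycle_type_on B s2 = mset mu"
      using that(1) by (auto simp: C_def configurations_def)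
    have "orbit s2 ` set R = cycles_on B s2"
      using orbit_root_list[OF finite_subset[OF x(2) fin] x(4)] that(2) by (simp add: RL_def)
    moreover have "s2 x \<in> B" if "x \<in> B" for x using that x(3) by blast
    ultimately show ?thesis
      using Union_cycles_on[OF permutes_imp_permutation[OF fin x(1)], of B] by simp
  qed
  have mk_mem: "mk ((s0, s1, s2, B), R) \<in> ?L" "- euler_char (mk ((s0, s1, s2, B), R)) =
      int (card V) - int (card (cycles_on V s0)) - int (card (cycles_on V s1))
        - int (card (cycles_on (V - B) s2))"
    if "(s0, s1, s2, B) \<in> C" "R \<in> RL (s0, s1, s2, B)" for s0 s1 s2 B R
  proof -
    let ?M = "mk ((s0, s1, s2, B), R)"
    have x: "s0 permutes V" "s1 permutes V" "s2 permutes V" "s0 \<circ> s1 \<circ> s2 = id"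
      "B \<subseteq> V" "s2 ` B = B" "cycle_type_on B s2 = mset mu" "Q s0 B"
      and a: "\<forall>i. Poly_Mapping.lookup a i = card {f \<in> cycles_on (V - B) s2. card f = i}"
      and b: "\<forall>i. Poly_Mapping.lookup b i = card {h \<in> cycles_on V s1. card h = i}"
      using that(1) by (auto simp: C_def configurations_def)
    have R: "set R \<subseteq> B" "distinct (map (orbit s2) R)" "map (\<lambda>r. card (orbit s2 r)) R = mu"
      using that(2) by (auto simp: RL_def root_lists_def)
    have h: "is_hypermap ?M"
      unfolding is_hypermap_def mk_def using x fin R by (auto simp: distinct_conv_nth)
    have B: "boundary_edges ?M = B"
      using cov[OF that] by (simp add: boundary_edges_def boundary_faces_def mk_def)
    have int: "internal_faces ?M = cycles_on (V - B) s2"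
      using internal_faces_eq[OF h] B by (simp add: mk_def)
    have "has_monomial ?M a b"
      unfolding has_monomial_def int using a b by (simp add: hyperedges_def mk_def)
    moreover have "map card (boundary_faces ?M) = mu"
      using R(3) by (simp add: boundary_faces_def mk_def o_def)
    moreover have "edges ?M = V" "sig0 ?M = s0" by (simp_all add: mk_def)
    ultimately show "?M \<in> ?L" using h x(8) B by simp
    show "- euler_char ?M = int (card V) - int (card (cycles_on V s0)) - int (card (cycles_on V s1))
        - int (card (cycles_on (V - B) s2))"
      unfolding euler_char_def int by (simp add: vertices_def hyperedges_def mk_def)
  qed
  have surj: "?L \<subseteq> mk ` (SIGMA x:C. RL x)"
  proof
    fix M assume M: "M \<in> ?L"
    let ?B = "boundary_edges M"
    have h: "is_hypermap M" and V: "edges M = V" and mu: "map card (boundary_faces M) = mu"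
      and mon: "has_monomial M a b" and Q: "Q (sig0 M) ?B" using M by auto
    have im: "sig2 M ` ?B = ?B"
    proof (rule endo_inj_surj)
      show "finite ?B" using boundary_edges_subset[OF h] V fin finite_subset by blast
      show "sig2 M ` ?B \<subseteq> ?B" using sig2_boundary_edges[OF h] by blast
      show "inj_on (sig2 M) ?B" using h by (auto simp: is_hypermap_def intro: permutes_inj_on)
    qed
    have "(sig0 M, sig1 M, sig2 M, ?B) \<in> C"
      using h V mon Q im boundary_edges_subset[OF h] internal_faces_eq[OF h]
        cycle_type_on_boundary_edges[OF h] mu
      unfolding C_def configurations_def
      by (simp add: is_hypermap_def has_monomial_def hyperedges_def)
    moreover have "roots M \<in> RL (sig0 M, sig1 M, sig2 M, ?B)"
      using distinct_boundary_faces[OF h] mu permutation_self_in_orbit[OF permutation_sig2[OF h]]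
      by (auto simp: RL_def root_lists_def boundary_faces_def boundary_edges_def o_def)
    moreover have "M = mk ((sig0 M, sig1 M, sig2 M, ?B), roots M)" using V by (simp add: mk_def)
    ultimately show "M \<in> mk ` (SIGMA x:C. RL x)" by (intro image_eqI[of _ mk]) auto
  qed
  have img: "mk ` (SIGMA x:C. RL x) = ?L"
  proof
    show "mk ` (SIGMA x:C. RL x) \<subseteq> ?L"
    proof (rule image_subsetI)
      fix y assume y: "y \<in> (SIGMA x:C. RL x)"
      obtain s0 s1 s2 B R where "y = ((s0, s1, s2, B), R)" by (metis surj_pair)
      then show "mk y \<in> ?L" using mk_mem(1)[of s0 s1 s2 B R] y by blast
    qed
  qed (rule surj)
  have inj: "inj_on mk (SIGMA x:C. RL x)"
  proof (rule inj_onI)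
    fix y z assume y: "y \<in> (SIGMA x:C. RL x)" and z: "z \<in> (SIGMA x:C. RL x)" and eq: "mk y = mk z"
    obtain s0 s1 s2 B R where y_eq: "y = ((s0, s1, s2, B), R)" by (metis surj_pair)
    obtain t0 t1 t2 B' R' where z_eq: "z = ((t0, t1, t2, B'), R')" by (metis surj_pair)
    have e: "s0 = t0" "s1 = t1" "s2 = t2" "R = R'" using eq unfolding y_eq z_eq mk_def by auto
    have "B = B'" using cov[of s0 s1 s2 B R] cov[of t0 t1 t2 B' R'] y z e unfolding y_eq z_eq by auto
    then show "y = z" using e unfolding y_eq z_eq by simp
  qed
  have finC: "finite C" unfolding C_def using finite_configurations[OF fin] by simp
  have cardRL: "finite (RL x) \<and> card (RL x) = zee mu" if xC: "x \<in> C" for x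
  proof -
    obtain s0 s1 s2 B where x_eq: "x = (s0, s1, s2, B)" by (metis surj_pair)
    have x: "s2 permutes V" "B \<subseteq> V" "s2 ` B = B" "cycle_type_on B s2 = mset mu"
      using xC by (auto simp: C_def configurations_def x_eq)
    have finB: "finite B" using x(2) fin finite_subset by blast
    show ?thesis
      using card_root_lists[OF finB permutes_imp_permutation[OF fin x(1)] _ x(4)] x(3)
        finite_root_lists[OF finB] by (auto simp: RL_def x_eq)
  qed
  show "finite ?L"
    unfolding img[symmetric] using finC cardRL by (intro finite_imageI finite_SigmaI) simp_all
  have "?sum = (\<Sum>y\<in>(SIGMA x:C. RL x). Poly_Mapping.single (- euler_char (mk y)) 1)"
    unfolding img[symmetric] by (rule sum.reindex[OF inj, unfolded o_def])
  also have "\<dots> = (\<Sum>y\<in>(SIGMA x:C. RL x). euler_weight V (fst y))"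
  proof (rule sum.cong[OF refl])
    fix y assume y: "y \<in> (SIGMA x:C. RL x)"
    obtain s0 s1 s2 B R where y_eq: "y = ((s0, s1, s2, B), R)" by (metis surj_pair)
    show "Poly_Mapping.single (- euler_char (mk y)) 1 = euler_weight V (fst y)"
      using mk_mem(2)[of s0 s1 s2 B R] y unfolding y_eq by simp
  qed
  also have "\<dots> = (\<Sum>x\<in>C. \<Sum>R\<in>RL x. euler_weight V x)"
    using finC cardRL by (subst sum.Sigma) (auto simp: case_prod_beta)
  also have "\<dots> = (\<Sum>x\<in>C. of_nat (zee mu) * euler_weight V x)"
    using cardRL by (intro sum.cong) simp_all
  finally show "?sum = ?rhs" by (simp add: sum_distrib_left C_def)
qed

section \<open>Hypermap enumerations in terms of configurations\<close>

text \<open>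
  The number of edges of the hypermaps that contribute to a given coefficient, see \<open>card_edges_eq\<close>.
\<close>

definition edge_count :: "nat list \<Rightarrow> (nat \<Rightarrow>\<^sub>0 nat) \<Rightarrow> nat" where
  "edge_count mu a = sum_list mu + (\<Sum>i\<in>Poly_Mapping.keys a. i * Poly_Mapping.lookup a i)"

lemma enumeration_eq_sum_configurations:
  fixes P :: "nat hypermap \<Rightarrow> bool" and mu :: "nat list"
    and a :: "nat \<Rightarrow>\<^sub>0 nat"
  defines "V \<equiv> {..<edge_count mu a}"
  assumes relabel: "\<And>g M. bij g \<Longrightarrow> P (relabel g M) \<longleftrightarrow> P M"
    and P: "\<And>M. is_hypermap M \<Longrightarrow> P M \<longleftrightarrow> Q (sig0 M) (boundary_edges M)"
  shows "of_nat (fact (edge_count mu a)) * enumeration P mu a b = of_nat (zee mu) *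
    (\<Sum>x | x \<in> configurations V a b \<and> boundary_type x = mset mu \<and>
       (case x of (s0, s1, s2, B) \<Rightarrow> Q s0 B). euler_weight V x)"
proof -
  let ?P = "\<lambda>M. P M \<and> map card (boundary_faces M) = mu \<and> has_monomial M a b"
  have L: "{M. is_hypermap M \<and> ?P M \<and> edges M = V} =
      {M. is_hypermap M \<and> edges M = V \<and> map card (boundary_faces M) = mu \<and> has_monomial M a b \<and>
          Q (sig0 M) (boundary_edges M)}"
    using P by blast
  have "of_nat (fact (edge_count mu a)) * enumeration P mu a b =
      (\<Sum>M | is_hypermap M \<and> ?P M \<and> edges M = V. Poly_Mapping.single (- euler_char M) 1)"
    unfolding enumeration_def V_def
  proof (rule sum_hweight_classes)
    show "?P (relabel g M)" if "bij g" "is_hypermap M" "?P M" for g M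
      using that by (simp only: relabel map_card_boundary_faces_relabel has_monomial_relabel)
    show "card (edges M) = edge_count mu a" if "is_hypermap M" "?P M" for M
      unfolding edge_count_def by (rule card_edges_eq[where b = b]) (use that in simp_all)
    show "finite {M. is_hypermap M \<and> ?P M \<and> edges M = {..<edge_count mu a}}"
      unfolding L[unfolded V_def] by (rule sum_labelled_hypermaps(1)) simp
  qed
  also have "\<dots> = of_nat (zee mu) * (\<Sum>x | x \<in> configurations V a b \<and> boundary_type x = mset mu \<and>
       (case x of (s0, s1, s2, B) \<Rightarrow> Q s0 B). euler_weight V x)"
    unfolding L by (rule sum_labelled_hypermaps(2)) (simp add: V_def)
  finally show ?thesis .
qed

section \<open>Regluing a simple boundary\<close>

fun boundary_set :: "('e \<Rightarrow> 'e) \<times> ('e \<Rightarrow> 'e) \<times> ('e \<Rightarrow> 'e) \<times> 'e set \<Rightarrow> 'e set" where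
  "boundary_set (s0, s1, s2, B) = B"

text \<open>
  The permutations of the boundary edges that turn the boundary degrees into \<open>lam\<close>.
\<close>

fun regluings :: "nat list \<Rightarrow> ('e \<Rightarrow> 'e) \<times> ('e \<Rightarrow> 'e) \<times> ('e \<Rightarrow> 'e) \<times> 'e set \<Rightarrow> ('e \<Rightarrow> 'e) set" where
  "regluings lam (s0, s1, s2, B) = {\<pi>. \<pi> permutes B \<and> cycle_type_on B (s2 \<circ> inv \<pi>) = mset lam}"

text \<open>
  On a fully simple configuration, \<open>\<pi>\<close> joins the vertices of boundary edges on a common cycle of \<open>\<pi>\<close>.
  The change of \<open>s2\<close> keeps the product of the three permutations equal to the identity.
\<close>

fun reglue ::
  "('e \<Rightarrow> 'e) \<Rightarrow> ('e \<Rightarrow> 'e) \<times> ('e \<Rightarrow> 'e) \<times> ('e \<Rightarrow> 'e) \<times> 'e set \<Rightarrow>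
   ('e \<Rightarrow> 'e) \<times> ('e \<Rightarrow> 'e) \<times> ('e \<Rightarrow> 'e) \<times> 'e set" where
  "reglue \<pi> (s0, s1, s2, B) = (\<pi> \<circ> s0, s1, s2 \<circ> inv \<pi>, B)"

lemma reglue_inv:
  assumes "\<pi> permutes boundary_set x"
  shows "reglue (inv \<pi>) (reglue \<pi> x) = x" "reglue \<pi> (reglue (inv \<pi>) x) = x"
proof -
  obtain s0 s1 s2 B where x: "x = (s0, s1, s2, B)" by (metis surj_pair)
  have \<pi>: "\<pi> permutes B" using assms by (simp add: x)
  note i = permutes_inv_o[OF \<pi>] permutes_inv_inv[OF \<pi>]
  show "reglue (inv \<pi>) (reglue \<pi> x) = x" "reglue \<pi> (reglue (inv \<pi>) x) = x"
    unfolding x reglue.simps i(3) o_assoc i(1,2)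
    by (simp_all only: id_comp comp_assoc i(1,2) comp_id)
qed

lemma cycles_on_reglue_outside:
  assumes "s2 permutes V" "s2 ` B = B" "\<pi> permutes B"
  shows "cycles_on (V - B) (s2 \<circ> inv \<pi>) = cycles_on (V - B) s2"
proof (rule cycles_on_cong[symmetric])
  fix x assume x: "x \<in> V - B"
  then show "s2 x = (s2 \<circ> inv \<pi>) x"
    using permutes_not_in[OF permutes_inv[OF assms(3)]] by simp
  have "s2 x \<notin> s2 ` B" using x permutes_inj[OF assms(1)] by (simp add: inj_image_mem_iff)
  then show "s2 x \<in> V - B" using x permutes_in_image[OF assms(1)] assms(2) by simp
qed

lemma reglue_configurations:
  assumes "x \<in> configurations V a b" "\<pi> permutes boundary_set x"
  shows "reglue \<pi> x \<in> configurations V a b"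
proof -
  obtain s0 s1 s2 B where x_eq: "x = (s0, s1, s2, B)" by (metis surj_pair)
  have x: "s0 permutes V" "s1 permutes V" "s2 permutes V" "s0 \<circ> s1 \<circ> s2 = id" "B \<subseteq> V" "s2 ` B = B"
    and mon: "\<forall>i. Poly_Mapping.lookup a i = card {f \<in> cycles_on (V - B) s2. card f = i}"
      "\<forall>i. Poly_Mapping.lookup b i = card {h \<in> cycles_on V s1. card h = i}"
    using assms(1) unfolding x_eq configurations_def by simp_all
  have \<pi>: "\<pi> permutes B" using assms(2) by (simp add: x_eq)
  have \<pi>V: "\<pi> permutes V" using permutes_subset[OF \<pi> x(5)] .
  have "(\<pi> \<circ> s0) \<circ> s1 \<circ> (s2 \<circ> inv \<pi>) = \<pi> \<circ> (s0 \<circ> s1 \<circ> s2) \<circ> inv \<pi>" by (simp only: comp_assoc)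
  also have "\<dots> = id" unfolding x(4) using permutes_inv_o(1)[OF \<pi>] by simp
  finally have "(\<pi> \<circ> s0) \<circ> s1 \<circ> (s2 \<circ> inv \<pi>) = id" .
  moreover have "(s2 \<circ> inv \<pi>) ` B = B"
    using permutes_image[OF permutes_inv[OF \<pi>]] x(6) by (simp only: image_comp[symmetric])
  moreover have "\<pi> \<circ> s0 permutes V" by (rule permutes_compose[OF x(1) \<pi>V])
  moreover have "s2 \<circ> inv \<pi> permutes V" by (rule permutes_compose[OF permutes_inv[OF \<pi>V] x(3)])
  ultimately show ?thesis
    unfolding x_eq reglue.simps configurations_def
    using x(2,5) mon cycles_on_reglue_outside[OF x(3,6) \<pi>] by simp
qed

text \<open>
  Edges, hyperedges and internal faces stay the same, so the weight changes through the number of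
  vertices alone, which is computed by \<open>card_cycles_on_comp\<close>.
\<close>

lemma euler_weight_reglue:
  assumes "finite V" "x \<in> configurations V a b" "simple_boundary x" "\<pi> permutes boundary_set x"
  shows "euler_weight V (reglue \<pi> x) = euler_weight V x *
    Poly_Mapping.single (int (card (boundary_set x)) - int (card (cycles_on (boundary_set x) \<pi>))) 1"
proof -
  obtain s0 s1 s2 B where x_eq: "x = (s0, s1, s2, B)" by (metis surj_pair)
  have x: "s0 permutes V" "s2 permutes V" "B \<subseteq> V" "s2 ` B = B" "separates s0 B" "\<pi> permutes B"
    using assms(2-4) unfolding x_eq configurations_def by simp_all
  have "card (cycles_on V (\<pi> \<circ> s0)) + card B = card (cycles_on V s0) + card (cycles_on B \<pi>)"
    by (rule card_cycles_on_comp[OF assms(1) x(3) permutes_imp_permutation[OF assms(1) x(1)] x(6,5)])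
  then have exponent: "int (card V) - int (card (cycles_on V (\<pi> \<circ> s0))) - int (card (cycles_on V s1))
        - int (card (cycles_on (V - B) s2)) =
      (int (card V) - int (card (cycles_on V s0)) - int (card (cycles_on V s1))
        - int (card (cycles_on (V - B) s2))) + (int (card B) - int (card (cycles_on B \<pi>)))"
    by linarith
  show ?thesis
    unfolding x_eq reglue.simps euler_weight.simps boundary_set.simps
      cycles_on_reglue_outside[OF x(2,4,6)] exponent mult_single by simp
qed

text \<open>
  Each configuration of boundary type \<open>lam\<close> is the regluing of a unique configuration with simple boundary by a
  unique permutation, namely the first return map of the vertex permutation to the boundary.
\<close>

lemma sum_regluings:
  fixes V :: "'e set"
  assumes fin: "finite V"
  shows "(\<Sum>x | x \<in> configurations V a b \<and> boundary_type x = mset lam. euler_weight V x) =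
    (\<Sum>x | x \<in> configurations V a b \<and> simple_boundary x \<and> card (boundary_set x) = sum_list lam.
       euler_weight V x * (\<Sum>\<pi>\<in>regluings lam x.
         Poly_Mapping.single (int (card (boundary_set x)) - int (card (cycles_on (boundary_set x) \<pi>))) 1))"
proof -
  define W where "W = {x \<in> configurations V a b. simple_boundary x \<and> card (boundary_set x) = sum_list lam}"
  define U where "U = {x \<in> configurations V a b. boundary_type x = mset lam}"
  have finB: "finite (boundary_set x)" if "x \<in> configurations V a b" for x
    using that fin by (cases x) (auto simp: configurations_def intro: finite_subset)
  have permutesB: "\<pi> permutes boundary_set x" if "\<pi> \<in> regluings lam x" for x and \<pi> :: "'e \<Rightarrow> 'e"
    using that by (cases x) auto
  have perm0: "permutation (fst x)" if "x \<in> configurations V a b" for x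
    using that fin by (cases x) (auto simp: configurations_def intro: permutes_imp_permutation)
  have return: "first_return (fst (reglue \<pi> x)) (boundary_set x) = \<pi>"
    if "x \<in> W" "\<pi> \<in> regluings lam x" for x \<pi>
    using that perm0[of x] by (cases x) (auto simp: W_def intro: first_return_comp)
  have bij: "bij_betw (\<lambda>(x, \<pi>). reglue \<pi> x) (SIGMA x:W. regluings lam x) U"
    unfolding bij_betw_def
  proof
    show "inj_on (\<lambda>(x, \<pi>). reglue \<pi> x) (SIGMA x:W. regluings lam x)"
    proof (rule inj_onI)
      fix y z assume y: "y \<in> (SIGMA x:W. regluings lam x)" and z: "z \<in> (SIGMA x:W. regluings lam x)"
        and eq: "(\<lambda>(x, \<pi>). reglue \<pi> x) y = (\<lambda>(x, \<pi>). reglue \<pi> x) z"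
      obtain x \<pi> where y_eq: "y = (x, \<pi>)" by (cases y)
      obtain x' \<pi>' where z_eq: "z = (x', \<pi>')" by (cases z)
      have m: "x \<in> W" "\<pi> \<in> regluings lam x" "x' \<in> W" "\<pi>' \<in> regluings lam x'"
        using y z by (auto simp: y_eq z_eq)
      have e: "reglue \<pi> x = reglue \<pi>' x'" using eq by (simp add: y_eq z_eq)
      then have "boundary_set x = boundary_set x'" by (cases x; cases x') simp
      then have "\<pi> = \<pi>'" using return[OF m(1,2)] return[OF m(3,4)] e by simp
      moreover from this have "x = x'"
        using e reglue_inv(1)[OF permutesB[OF m(2)]] reglue_inv(1)[OF permutesB[OF m(4)]] by metis
      ultimately show "y = z" by (simp add: y_eq z_eq)
    qed
    show "(\<lambda>(x, \<pi>). reglue \<pi> x) ` (SIGMA x:W. regluings lam x) = U"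
    proof
      show "(\<lambda>(x, \<pi>). reglue \<pi> x) ` (SIGMA x:W. regluings lam x) \<subseteq> U"
      proof (rule image_subsetI)
        fix y assume y: "y \<in> (SIGMA x:W. regluings lam x)"
        obtain x \<pi> where y_eq: "y = (x, \<pi>)" by (cases y)
        have m: "x \<in> configurations V a b" "\<pi> \<in> regluings lam x" using y by (auto simp: y_eq W_def)
        have "boundary_type (reglue \<pi> x) = mset lam" using m(2) by (cases x) simp
        then show "(\<lambda>(x, \<pi>). reglue \<pi> x) y \<in> U"
          using reglue_configurations[OF m(1) permutesB[OF m(2)]] by (simp add: y_eq U_def)
      qed
      show "U \<subseteq> (\<lambda>(x, \<pi>). reglue \<pi> x) ` (SIGMA x:W. regluings lam x)"
      proof
        fix u assume u: "u \<in> U"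
        then have uc: "u \<in> configurations V a b" by (simp add: U_def)
        \<comment> \<open>Undo the pinching of the boundary of \<open>u\<close>.\<close>
        define \<pi> where "\<pi> = first_return (fst u) (boundary_set u)"
        have \<pi>: "\<pi> permutes boundary_set u"
          unfolding \<pi>_def by (rule first_return_permutes[OF perm0[OF uc] finB[OF uc]])
        define x where "x = reglue (inv \<pi>) u"
        have u_eq: "u = reglue \<pi> x" unfolding x_def using reglue_inv(2)[OF \<pi>] by simp
        have xc: "x \<in> configurations V a b"
          unfolding x_def by (rule reglue_configurations[OF uc permutes_inv[OF \<pi>]])
        obtain s0 s1 s2 B where u4: "u = (s0, s1, s2, B)" by (metis surj_pair)
        have \<pi>B: "\<pi> permutes B" using \<pi> by (simp add: u4)
        have "simple_boundary x"
          using separates_first_return[OF perm0[OF uc] finB[OF uc]]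
          unfolding x_def \<pi>_def u4 by simp
        moreover have "card (boundary_set x) = sum_list lam"
        proof -
          have "s2 permutes V" "s2 ` B = B" "cycle_type_on B s2 = mset lam"
            using u unfolding u4 U_def configurations_def by simp_all
          then have "card B = sum_mset (mset lam)"
            using sum_mset_cycle_type_on[of B s2] finB[OF uc] permutes_imp_permutation[OF fin] u4
            by (metis boundary_set.simps image_eqI)
          then show ?thesis by (simp add: x_def u4 sum_mset_sum_list)
        qed
        moreover have "\<pi> \<in> regluings lam x"
        proof -
          have "s2 \<circ> inv (inv \<pi>) \<circ> inv \<pi> = s2"
            unfolding permutes_inv_inv[OF \<pi>B] comp_assoc permutes_inv_o(1)[OF \<pi>B] by simp
          moreover have "cycle_type_on B s2 = mset lam" using u by (simp add: U_def u4)
          ultimately show ?thesis using \<pi>B by (simp add: x_def u4)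
        qed
        ultimately have "(x, \<pi>) \<in> (SIGMA x:W. regluings lam x)" using xc by (simp add: W_def)
        then show "u \<in> (\<lambda>(x, \<pi>). reglue \<pi> x) ` (SIGMA x:W. regluings lam x)"
          by (rule rev_image_eqI) (simp add: u_eq)
      qed
    qed
  qed
  have finW: "finite W" unfolding W_def using finite_configurations[OF fin] by simp
  have finR: "finite (regluings lam x)" if "x \<in> W" for x
  proof (rule finite_subset)
    show "regluings lam x \<subseteq> {\<pi>. \<pi> permutes boundary_set x}" using permutesB by blast
    show "finite {\<pi>. \<pi> permutes boundary_set x}"
      using that finB by (intro finite_permutations) (simp add: W_def)
  qed
  have "(\<Sum>x\<in>U. euler_weight V x) = (\<Sum>(x, \<pi>)\<in>(SIGMA x:W. regluings lam x). euler_weight V (reglue \<pi> x))"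
    using sum.reindex_bij_betw[OF bij, of "euler_weight V"] by (simp add: case_prod_beta)
  also have "\<dots> = (\<Sum>x\<in>W. \<Sum>\<pi>\<in>regluings lam x. euler_weight V (reglue \<pi> x))"
    using finW finR by (intro sum.Sigma[symmetric]) simp_all
  also have "\<dots> = (\<Sum>x\<in>W. euler_weight V x * (\<Sum>\<pi>\<in>regluings lam x.
      Poly_Mapping.single (int (card (boundary_set x)) - int (card (cycles_on (boundary_set x) \<pi>))) 1))"
    unfolding sum_distrib_left
    by (intro sum.cong refl euler_weight_reglue[OF fin]) (auto simp: W_def dest: permutesB)
  finally show ?thesis unfolding U_def W_def by simp
qed

text \<open>
  The restriction \<open>\<alpha>\<close> of \<open>s2\<close> to the boundary has type \<open>mu\<close>. As \<open>\<alpha> \<circ> inv \<pi>\<close> is the inverse of \<open>\<pi> \<circ> inv \<alpha>\<close>, the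
  sum is the cofactor series of \<open>inv \<alpha>\<close>.
\<close>

lemma sum_regluings_eq_hurwitz_series:
  fixes x :: "(nat \<Rightarrow> nat) \<times> (nat \<Rightarrow> nat) \<times> (nat \<Rightarrow> nat) \<times> nat set"
  assumes "finite V" "x \<in> configurations V a b" "boundary_type x = mset mu"
    and "sum_list lam = card (boundary_set x)"
  shows "(\<Sum>\<pi>\<in>regluings lam x.
      Poly_Mapping.single (int (card (boundary_set x)) - int (card (cycles_on (boundary_set x) \<pi>))) 1) =
    of_nat (zee mu) * hurwitz_series lam mu"
proof -
  obtain s0 s1 s2 B where x_eq: "x = (s0, s1, s2, B)" by (metis surj_pair)
  have x: "s2 permutes V" "B \<subseteq> V" "s2 ` B = B" "cycle_type_on B s2 = mset mu" "sum_list lam = card B"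
    using assms(2-4) unfolding x_eq configurations_def by simp_all
  have finB: "finite B" using x(2) assms(1) finite_subset by blast
  have s2B: "s2 y \<in> B" if "y \<in> B" for y using x(3) that by blast
  define \<alpha> where "\<alpha> = restrict_id s2 B"
  have "bij_betw s2 B B" using x(3) permutes_inj_on[OF x(1)] by (simp add: bij_betw_def)
  then have \<alpha>: "\<alpha> permutes B" unfolding \<alpha>_def by (rule permutes_restrict_id)
  have inv_type: "cycle_type_on B (inv p) = cycle_type_on B p" if "p permutes B" for p
    unfolding cycle_type_on_def using cycles_on_inv[OF permutes_imp_permutation[OF finB that]] by simp
  have "cycle_type_on B \<alpha> = cycle_type_on B s2"
    by (rule cycle_type_on_cong) (simp_all add: \<alpha>_def s2B)
  then have type: "cycle_type_on B (inv \<alpha>) = mset mu" using inv_type[OF \<alpha>] x(4) by simp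
  have eq: "cycle_type_on B (s2 \<circ> inv \<pi>) = cycle_type_on B (\<pi> \<circ> inv \<alpha>)" if \<pi>: "\<pi> permutes B" for \<pi>
  proof -
    have p: "\<pi> \<circ> inv \<alpha> permutes B" by (rule permutes_compose[OF permutes_inv[OF \<alpha>] \<pi>])
    have "inv (\<pi> \<circ> inv \<alpha>) = \<alpha> \<circ> inv \<pi>"
      using o_inv_distrib[OF permutes_bij[OF \<pi>] permutes_bij[OF permutes_inv[OF \<alpha>]]]
        permutes_inv_inv[OF \<alpha>] by simp
    moreover have "cycle_type_on B (s2 \<circ> inv \<pi>) = cycle_type_on B (\<alpha> \<circ> inv \<pi>)"
      by (rule cycle_type_on_cong[symmetric])
        (use permutes_in_image[OF permutes_inv[OF \<pi>]] in \<open>simp_all add: \<alpha>_def s2B\<close>)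
    ultimately show ?thesis using inv_type[OF p] by simp
  qed
  have "regluings lam x = {\<pi>. \<pi> permutes B \<and> cycle_type_on B (\<pi> \<circ> inv \<alpha>) = mset lam}"
    unfolding x_eq regluings.simps using eq by (auto simp del: o_apply)
  then have "(\<Sum>\<pi>\<in>regluings lam x.
      Poly_Mapping.single (int (card (boundary_set x)) - int (card (cycles_on (boundary_set x) \<pi>))) 1) =
      cofactor_series B lam (inv \<alpha>)"
    by (simp add: cofactor_series_def x_eq)
  also have "\<dots> = of_nat (zee mu) * hurwitz_series lam mu"
    by (rule cofactor_series_eq_hurwitz_series[OF finB x(5) permutes_inv[OF \<alpha>] type])
  finally show ?thesis .
qed

section \<open>Partitions\<close>

lemma length_le_sum_list: "\<forall>x\<in>set xs. 0 < x \<Longrightarrow> length xs \<le> sum_list (xs :: nat list)"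
  by (induct xs) auto

lemma finite_partitions: "finite {mu. is_partition d mu}"
proof (rule finite_subset)
  show "{mu. is_partition d mu} \<subseteq> {mu. set mu \<subseteq> {..d} \<and> length mu \<le> d}"
    using length_le_sum_list member_le_sum_list by (fastforce simp: is_partition_def)
qed (rule finite_lists_length_le[OF finite_atMost])

text \<open>
  Partitions are weakly decreasing lists, so each multiset of cycle lengths belongs to exactly one.
\<close>

lemma partition_eq_iff_mset:
  assumes "is_partition d mu"
  shows "rev (sorted_list_of_multiset T) = mu \<longleftrightarrow> T = mset mu"
proof
  assume "rev (sorted_list_of_multiset T) = mu"
  then show "T = mset mu" by (metis mset_rev mset_sorted_list_of_multiset)
next
  assume "T = mset mu"
  moreover have "sorted (rev mu)" using assms by (simp add: is_partition_def sorted_wrt_rev)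
  ultimately have "sorted_list_of_multiset T = rev mu"
    by (metis mset_rev sorted_list_of_multiset_mset sorted_sort_id)
  then show "rev (sorted_list_of_multiset T) = mu" by simp
qed

lemma is_partition_rev_sorted_list:
  assumes "sum_mset T = d" "\<And>k. k \<in># T \<Longrightarrow> 0 < k"
  shows "is_partition d (rev (sorted_list_of_multiset T))"
proof -
  have "sum_list (sorted_list_of_multiset T) = d"
    using assms(1) by (metis mset_sorted_list_of_multiset sum_mset_sum_list)
  moreover have "set (sorted_list_of_multiset T) = set_mset T" by simp
  moreover have "sorted (sorted_list_of_multiset T)" by simp
  ultimately show ?thesis
    using assms(2) unfolding is_partition_def by (simp add: sorted_wrt_rev sum_list_rev)
qed

section \<open>Ordinary from fully simple hypermaps\<close>

text \<open>
  All coefficients are compared after multiplication by the factorial of the common number of edges.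
  The fully simple configurations are grouped by the partition \<open>mu\<close> formed by their boundary degrees.
\<close>

theorem theorem5p7:
  fixes d :: nat and lam :: "nat list"
  assumes "0 < d" and "is_partition d lam"
  shows "Map_h lam =
    (\<lambda>a b. of_nat (zee lam) *
       (\<Sum>mu | is_partition d mu. hurwitz_series lam mu * FSMap_h mu a b))"
proof (intro ext)
  fix a b :: "nat \<Rightarrow>\<^sub>0 nat"
  define N where "N = edge_count lam a"
  define V where "V = {..<N}"
  have sum_lam: "sum_list lam = d" using assms(2) by (simp add: is_partition_def)
  have N: "edge_count mu a = N" if "is_partition d mu" for mu
    using that sum_lam by (simp add: N_def edge_count_def is_partition_def)
  define W where "W = {x \<in> configurations V a b. simple_boundary x \<and> card (boundary_set x) = d}"
  define S where "S mu = {x \<in> configurations V a b. boundary_type x = mset mu \<and> simple_boundary x}" for mu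
  have finV: "finite V" by (simp add: V_def)
  have finW: "finite W" unfolding W_def using finite_configurations[OF finV] by simp
  have size: "sum_mset (boundary_type x) = card (boundary_set x) \<and> (\<forall>k\<in>#boundary_type x. 0 < k)"
    if "x \<in> configurations V a b" for x
  proof -
    obtain s0 s1 s2 B where x_eq: "x = (s0, s1, s2, B)" by (metis surj_pair)
    have x: "s2 permutes V" "B \<subseteq> V" "s2 ` B = B"
      using that unfolding x_eq configurations_def by simp_all
    have finB: "finite B" using x(2) finV finite_subset by blast
    have p: "permutation s2" by (rule permutes_imp_permutation[OF finV x(1)])
    show ?thesis
      using sum_mset_cycle_type_on[OF finB p] cycle_type_on_pos[OF p _ finB] x(3)
      by (auto simp: x_eq)
  qed
  define part where "part x = rev (sorted_list_of_multiset (boundary_type x))"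
    for x :: "(nat \<Rightarrow> nat) \<times> (nat \<Rightarrow> nat) \<times> (nat \<Rightarrow> nat) \<times> nat set"
  have fibre: "{x \<in> W. part x = mu} = S mu" if "is_partition d mu" for mu
  proof -
    have "card (boundary_set x) = d" if "x \<in> configurations V a b" "boundary_type x = mset mu" for x
      using size[OF that(1)] that(2) \<open>is_partition d mu\<close>
      by (simp add: is_partition_def sum_mset_sum_list)
    then show ?thesis
      using partition_eq_iff_mset[OF that] unfolding W_def S_def part_def by auto
  qed
  have fs: "of_nat (fact N) * FSMap_h mu a b = of_nat (zee mu) * (\<Sum>x\<in>S mu. euler_weight V x)"
    if "is_partition d mu" for mu
  proof -
    have "(case x of (s0, s1, s2, B) \<Rightarrow> separates s0 B) \<longleftrightarrow> simple_boundary x"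
      for x :: "(nat \<Rightarrow> nat) \<times> (nat \<Rightarrow> nat) \<times> (nat \<Rightarrow> nat) \<times> nat set"
      by (cases x) simp
    then show ?thesis
      using enumeration_eq_sum_configurations[of fully_simple separates mu a b,
          OF fully_simple_relabel fully_simple_iff_separates]
      unfolding N[OF that] FSMap_h_def V_def S_def by simp
  qed
  have "of_nat (fact N) * Map_h lam a b = of_nat (zee lam) *
      (\<Sum>x | x \<in> configurations V a b \<and> boundary_type x = mset lam. euler_weight V x)"
    using enumeration_eq_sum_configurations[of "\<lambda>_. True" "\<lambda>_ _. True" lam a b]
    unfolding N_def Map_h_def V_def by simp
  also have "(\<Sum>x | x \<in> configurations V a b \<and> boundary_type x = mset lam. euler_weight V x) =
      (\<Sum>x\<in>W. euler_weight V x * (\<Sum>\<pi>\<in>regluings lam x.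
         Poly_Mapping.single (int (card (boundary_set x)) - int (card (cycles_on (boundary_set x) \<pi>))) 1))"
    unfolding sum_regluings[OF finV] W_def sum_lam ..
  also have "\<dots> = (\<Sum>mu | is_partition d mu. \<Sum>x\<in>{x \<in> W. part x = mu}.
      euler_weight V x * (\<Sum>\<pi>\<in>regluings lam x.
         Poly_Mapping.single (int (card (boundary_set x)) - int (card (cycles_on (boundary_set x) \<pi>))) 1))"
  proof (rule sum.group[symmetric, OF finW finite_partitions])
    show "part ` W \<subseteq> {mu. is_partition d mu}"
    proof (rule image_subsetI)
      fix x assume "x \<in> W"
      then have "x \<in> configurations V a b" "card (boundary_set x) = d" by (simp_all add: W_def)
      then show "part x \<in> {mu. is_partition d mu}"
        unfolding part_def using size[of x] by (simp add: is_partition_rev_sorted_list)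
    qed
  qed
  also have "\<dots> = (\<Sum>mu | is_partition d mu. of_nat (fact N) * (hurwitz_series lam mu * FSMap_h mu a b))"
  proof (rule sum.cong[OF refl])
    fix mu assume "mu \<in> {mu. is_partition d mu}"
    then have mu: "is_partition d mu" by simp
    have "(\<Sum>x\<in>{x \<in> W. part x = mu}. euler_weight V x * (\<Sum>\<pi>\<in>regluings lam x.
         Poly_Mapping.single (int (card (boundary_set x)) - int (card (cycles_on (boundary_set x) \<pi>))) 1)) =
       (\<Sum>x\<in>S mu. euler_weight V x * (of_nat (zee mu) * hurwitz_series lam mu))"
    proof (rule sum.cong[OF fibre[OF mu]])
      fix x assume x: "x \<in> S mu"
      then have "x \<in> W" using fibre[OF mu] by blast
      then show "euler_weight V x * (\<Sum>\<pi>\<in>regluings lam x.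
         Poly_Mapping.single (int (card (boundary_set x)) - int (card (cycles_on (boundary_set x) \<pi>))) 1) =
         euler_weight V x * (of_nat (zee mu) * hurwitz_series lam mu)"
        using sum_regluings_eq_hurwitz_series[OF finV, of x a b mu lam] x sum_lam
        by (simp add: S_def W_def)
    qed
    also have "\<dots> = hurwitz_series lam mu * (of_nat (zee mu) * (\<Sum>x\<in>S mu. euler_weight V x))"
      by (simp add: sum_distrib_left sum_distrib_right mult_ac)
    also have "\<dots> = of_nat (fact N) * (hurwitz_series lam mu * FSMap_h mu a b)"
      unfolding fs[OF mu, symmetric] by (rule mult.left_commute)
    finally show "(\<Sum>x\<in>{x \<in> W. part x = mu}. euler_weight V x * (\<Sum>\<pi>\<in>regluings lam x.
         Poly_Mapping.single (int (card (boundary_set x)) - int (card (cycles_on (boundary_set x) \<pi>))) 1)) =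
       of_nat (fact N) * (hurwitz_series lam mu * FSMap_h mu a b)" .
  qed
  also have "of_nat (zee lam) *
      (\<Sum>mu | is_partition d mu. of_nat (fact N) * (hurwitz_series lam mu * FSMap_h mu a b)) =
      of_nat (fact N) * (of_nat (zee lam) *
      (\<Sum>mu | is_partition d mu. hurwitz_series lam mu * FSMap_h mu a b))"
    unfolding sum_distrib_left[symmetric] by (rule mult.left_commute)
  finally have "of_nat (fact N) * Map_h lam a b = of_nat (fact N) * (of_nat (zee lam) *
      (\<Sum>mu | is_partition d mu. hurwitz_series lam mu * FSMap_h mu a b))" .
  moreover have "of_nat (fact N) \<noteq> (0 :: laurent)"
  proof
    assume "of_nat (fact N) = (0 :: laurent)"
    moreover have "Poly_Mapping.single 0 (1 / fact N) * of_nat (fact N) = (1 :: laurent)"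
      by (simp add: mult_single flip: single_of_nat)
    ultimately show False by simp
  qed
  ultimately show "Map_h lam a b = of_nat (zee lam) *
      (\<Sum>mu | is_partition d mu. hurwitz_series lam mu * FSMap_h mu a b)"
    by simp
qed

end
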